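(* Let $q$ be a prime power and let $n\ge 2$, $k$, $M$ be positive integers with $k\leq n$ and $M\leq \genfrac{[}{]}{0pt}{}{n}{k}_q$. Let $V$ be an $n$-dimensional vector space over $\mathbb{F}_q$. For $\mathcal{F}\subseteq \genfrac{[}{]}{0pt}{}{V}{k}$ with $|\mathcal{F}|=M$, we have $$\mathcal{MI}(\mathcal{F})\le\left(\frac{\genfrac{[}{]}{0pt}{}{n}{k}_q}{M}-\genfrac{[}{]}{0pt}{}{n}{1}_q\right)\frac{qM^2\genfrac{[}{]}{0pt}{}{k}{1}_q\genfrac{[}{]}{0pt}{}{n-k}{1}_q}{\genfrac{[}{]}{0pt}{}{n}{1}_q\left(\genfrac{[}{]}{0pt}{}{n}{1}_q-1\right)}+kM^2.$$ Especially, when $n\ge 2k$, $n\geq 3$ and $M\leq\genfrac{[}{]}{0pt}{}{n-1}{k-1}_q$, we have $$\mathcal{MI}(\mathcal{F})\leq\left[\frac{\genfrac{[}{]}{0pt}{}{n}{k}_q}{M}-\frac{(q^n-1)(q^{n-1}-1)}{(q-1)(q^k-1)}\right]\frac{M^2(q^k-1)(q^{k-1}-1)(q^{n-k}-1)}{(q^n-1)(q^{n-1}-1)(q^{n-2}-1)}+kM^2.$$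
   Context: $\mathbb{F}_q$ is the finite field with $q$ elements. The Gaussian binomial coefficient is $\genfrac{[}{]}{0pt}{}{n}{k}_q=\prod_{i=0}^{k-1}\frac{q^{n-i}-1}{q^{k-i}-1}$ (so $\genfrac{[}{]}{0pt}{}{m}{1}_q=\frac{q^m-1}{q-1}$). $\genfrac{[}{]}{0pt}{}{V}{k}$ denotes the collection of all $k$-dimensional subspaces of $V$. For $\mathcal{F}\subseteq \genfrac{[}{]}{0pt}{}{V}{k}$, the total intersection number is $\mathcal{I}(\mathcal{F})=\sum_{A\in\mathcal{F}}\sum_{B\in\mathcal{F}}\dim(A\cap B)$ (sum over ordered pairs, including $A=B$), and $\mathcal{MI}(\mathcal{F})=\max\{\mathcal{I}(\mathcal{G}):\mathcal{G}\subseteq \genfrac{[}{]}{0pt}{}{V}{k},\ |\mathcal{G}|=|\mathcal{F}|\}$. *)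

theory Defs
  imports "HOL-Analysis.Analysis" "HOL-Number_Theory.Prime_Powers"
begin

(* The truncated subtraction n - i is harmless: for k \<le> n it is an ordinary difference, and for
   n < k the factor with i = n vanishes, as it does with integer exponents. *)
definition gauss_binomial :: "nat \<Rightarrow> nat \<Rightarrow> nat \<Rightarrow> real" where
  "gauss_binomial q n k = (\<Prod>i<k. (real q ^ (n - i) - 1) / (real q ^ (k - i) - 1))"

(* The ambient space V is the whole type 'v with scalar multiplication smul. The unqualified
   constants subspace and dim would be those of real vector spaces, hence the locale-qualified
   ones. The definitions are meant for finite-dimensional V: the library sets dim S = 0 for
   infinite-dimensional S. *)
definition subspaces_of_dim ::
    "('f::field \<Rightarrow> 'v::ab_group_add \<Rightarrow> 'v) \<Rightarrow> nat \<Rightarrow> 'v set set" where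
  "subspaces_of_dim smul k = {S. module.subspace smul S \<and> vector_space.dim smul S = k}"

definition total_intersection ::
    "('f::field \<Rightarrow> 'v::ab_group_add \<Rightarrow> 'v) \<Rightarrow> 'v set set \<Rightarrow> nat" where
  "total_intersection smul \<F> = (\<Sum>A\<in>\<F>. \<Sum>B\<in>\<F>. vector_space.dim smul (A \<inter> B))"

(* Max is a genuine maximum when V is a finite set and \<F> \<subseteq> subspaces_of_dim smul k: the set is
   then finite, and it contains the value at \<F> itself. *)
definition max_total_intersection ::
    "('f::field \<Rightarrow> 'v::ab_group_add \<Rightarrow> 'v) \<Rightarrow> nat \<Rightarrow> 'v set set \<Rightarrow> nat" where
  "max_total_intersection smul k \<F> =
     Max {total_intersection smul \<G> | \<G>.
            \<G> \<subseteq> subspaces_of_dim smul k \<and> card \<G> = card \<F>}"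

end

theory Submission
  imports Defs
begin

text \<open>Write \<open>k - dim (A \<inter> B) \<ge> \<kappa> (q ^ k - q ^ dim (A \<inter> B))\<close> with \<open>\<kappa> = q / (q ^ k (q - 1))\<close>. The claim then
  follows once the kernel
  \<open>H(A, B) = \<alpha> [A = B] + \<beta> + \<gamma> q ^ dim (A \<inter> B) + \<psi> [A \<inter> B = {0}]\<close> with \<open>\<gamma> = - \<kappa>\<close>, \<open>\<psi> \<le> 0\<close> is positive
  semidefinite on the \<open>k\<close>-spaces: evaluate it at the indicator function of the family. Its eigenvalues are
  indexed by \<open>j = 0, \<dots>, k\<close> as in the Grassmann scheme. The first bound takes \<open>\<psi> = 0\<close> and makes the
  eigenvalues for \<open>j = 0, 1\<close> vanish; the second one uses \<open>\<psi>\<close> to make that for \<open>j = 2\<close> vanish too, and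
  \<open>2 k \<le> n\<close> makes the remaining eigenvalues nonnegative.\<close>

subsection \<open>Quadratic forms and their eigenvalues\<close>

text \<open>The form attains its minimum on the compact unit sphere of the functions on
  \<open>S\<close>. A minimiser is an eigenvector whose eigenvalue is that minimum, so the minimum
  is nonnegative, and homogeneity carries this to every vector.\<close>

lemma quadratic_form_nonneg_if_eigenvalues_nonneg:
  fixes H :: "'a \<Rightarrow> 'a \<Rightarrow> real"
  assumes fin: "finite S"
    and sym: "\<And>a b. a \<in> S \<Longrightarrow> b \<in> S \<Longrightarrow> H a b = H b a"
    and eig: "\<And>\<theta> x. \<exists>a\<in>S. x a \<noteq> 0 \<Longrightarrow> \<forall>a\<in>S. (\<Sum>b\<in>S. H a b * x b) = \<theta> * x a \<Longrightarrow> 0 \<le> \<theta>"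
  shows "0 \<le> (\<Sum>a\<in>S. \<Sum>b\<in>S. H a b * x a * x b)"
proof (cases "S = {}")
  case False
  then obtain a0 where a0: "a0 \<in> S" by blast
  define Q where "Q = (\<lambda>x. \<Sum>a\<in>S. \<Sum>b\<in>S. H a b * x a * x b)"
  define P where "P = (\<lambda>x::'a \<Rightarrow> real. \<Sum>a\<in>S. (x a)\<^sup>2)"
  \<comment> \<open>The type \<open>'a\<close> may be infinite, so functions are forced to vanish
    off \<open>S\<close>. The box is then a product of compact sets, and \<open>Z\<close> is a copy
    of the unit sphere of the real functions on \<open>S\<close>.\<close>
  define box where "box = Pi\<^sub>E UNIV (\<lambda>a. if a \<in> S then {-1..1::real} else {0})"
  define Z where "Z = box \<inter> P -` {1}"
  have contP: "continuous_on UNIV P" and contQ: "continuous_on UNIV Q"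
    unfolding P_def Q_def by (intro continuous_intros continuous_on_product_coordinates)+
  have "compactin (product_topology (\<lambda>_. euclidean) UNIV) box"
    unfolding box_def by (subst compactin_PiE) (auto simp: compactin_euclidean_iff)
  then have "compact box"
    by (simp add: euclidean_product_topology)
  moreover have "closed (P -` {1})"
    using contP by (simp add: closed_vimage)
  ultimately have "compact Z"
    unfolding Z_def by (rule compact_Int_closed)
  moreover have "(\<lambda>a. of_bool (a = a0)) \<in> Z"
    using a0 fin by (auto simp: Z_def box_def P_def of_bool_def if_distrib[of "\<lambda>x. x ^ 2"] cong: if_cong)
  then have "Z \<noteq> {}" by blast
  ultimately obtain z where z: "z \<in> Z" and zmin: "\<And>y. y \<in> Z \<Longrightarrow> Q z \<le> Q y"
    using continuous_attains_inf[of Z Q] continuous_on_subset[OF contQ] by blast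
  have Pz: "P z = 1" using z by (simp add: Z_def)
  have scale: "Q (\<lambda>a. c * y a) = c\<^sup>2 * Q y" "P (\<lambda>a. c * y a) = c\<^sup>2 * P y" for c y
    by (simp_all add: Q_def P_def sum_distrib_left power2_eq_square algebra_simps)
  have Q_ge: "Q z * P y \<le> Q y" for y
  proof (cases "P y = 0")
    case True
    then have "\<forall>a\<in>S. y a = 0"
      using fin by (simp add: P_def sum_nonneg_eq_0_iff)
    then show ?thesis by (simp add: Q_def True)
  next
    case False
    have nn: "P y \<ge> 0" by (simp add: P_def sum_nonneg)
    with False have pos: "P y > 0" by simp
    define c where "c = 1 / sqrt (P y)"
    have c2: "c\<^sup>2 * P y = 1" using pos by (simp add: c_def power_divide)
    \<comment> \<open>Normalising \<open>y\<close> is not enough to land in \<open>Z\<close>: its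
      values off \<open>S\<close>, which affect neither \<open>P\<close> nor \<open>Q\<close>, must
      be cut off as well.\<close>
    define w where "w = (\<lambda>a. if a \<in> S then c * y a else 0)"
    have "P w = P (\<lambda>a. c * y a)" "Q w = Q (\<lambda>a. c * y a)"
      by (auto simp: P_def Q_def w_def intro!: sum.cong)
    then have Pw: "P w = 1" and Qw: "Q w = c\<^sup>2 * Q y"
      by (simp_all add: scale c2)
    have "(w a)\<^sup>2 \<le> 1" if "a \<in> S" for a
      using member_le_sum[of a S "\<lambda>a. (w a)\<^sup>2"] that fin Pw by (simp add: P_def)
    then have "\<bar>w a\<bar> \<le> 1" if "a \<in> S" for a
      using that by (simp add: abs_square_le_1)
    then have "w \<in> Z"
      using Pw by (force simp: Z_def box_def w_def abs_le_iff)
    from zmin[OF this] have "Q z * P y \<le> c\<^sup>2 * Q y * P y"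
      using nn by (simp add: Qw mult_right_mono)
    also have "\<dots> = Q y" using c2 by (simp add: mult.assoc mult.left_commute)
    finally show ?thesis .
  qed
  \<comment> \<open>First variation at the minimiser: moving \<open>z\<close> by \<open>t\<close> in
    the coordinate \<open>a\<close> changes \<open>Q - Q z * P\<close> by
    \<open>2 * t * L + t^2 * K\<close>, which is never negative, so the linear coefficient
    vanishes.\<close>
  have "(\<Sum>b\<in>S. H a b * z b) = Q z * z a" if a: "a \<in> S" for a
  proof -
    define L where "L = (\<Sum>b\<in>S. H a b * z b) - Q z * z a"
    define K where "K = H a a - Q z"
    have expand: "Q (\<lambda>b. z b + t * of_bool (b = a)) = Q z + 2 * t * (\<Sum>b\<in>S. H a b * z b) + t\<^sup>2 * H a a" for t
    proof -
      have "Q (\<lambda>b. z b + t * of_bool (b = a)) =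
         (\<Sum>c\<in>S. \<Sum>b\<in>S. H c b * z c * z b + t * (of_bool (c = a) * (H c b * z b))
            + t * (of_bool (b = a) * (H c b * z c)) + t\<^sup>2 * (of_bool (c = a) * (of_bool (b = a) * H c b)))"
        by (simp add: Q_def power2_eq_square algebra_simps)
      also have "\<dots> = Q z + t * (\<Sum>c\<in>S. of_bool (c = a) * (\<Sum>b\<in>S. H c b * z b))
            + t * (\<Sum>c\<in>S. \<Sum>b\<in>S. of_bool (b = a) * (H c b * z c))
            + t\<^sup>2 * (\<Sum>c\<in>S. of_bool (c = a) * (\<Sum>b\<in>S. of_bool (b = a) * H c b))"
        by (simp add: Q_def sum.distrib sum_distrib_left)
      also have "\<dots> = Q z + t * (\<Sum>b\<in>S. H a b * z b) + t * (\<Sum>c\<in>S. H c a * z c) + t\<^sup>2 * H a a"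
        using a fin by (simp add: of_bool_def if_distrib[of "\<lambda>x. x * _"] sum.delta cong: if_cong)
      also have "(\<Sum>c\<in>S. H c a * z c) = (\<Sum>b\<in>S. H a b * z b)"
        using sym a by (intro sum.cong) auto
      finally show ?thesis by (simp add: algebra_simps)
    qed
    have expandP: "P (\<lambda>b. z b + t * of_bool (b = a)) = 1 + 2 * t * z a + t\<^sup>2" for t
    proof -
      have "P (\<lambda>b. z b + t * of_bool (b = a)) =
        (\<Sum>b\<in>S. (z b)\<^sup>2 + 2 * t * (of_bool (b = a) * z b) + t\<^sup>2 * of_bool (b = a))"
        by (auto simp: P_def power2_eq_square algebra_simps intro!: sum.cong)
      also have "\<dots> = P z + 2 * t * (\<Sum>b\<in>S. of_bool (b = a) * z b) + t\<^sup>2 * (\<Sum>b\<in>S. of_bool (b = a))"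
        by (simp add: P_def sum.distrib sum_distrib_left)
      also have "\<dots> = 1 + 2 * t * z a + t\<^sup>2"
        using a fin Pz by (simp add: of_bool_def if_distrib[of "\<lambda>x. x * _"] sum.delta cong: if_cong)
      finally show ?thesis .
    qed
    have key: "0 \<le> 2 * t * L + t\<^sup>2 * K" for t
      using Q_ge[of "\<lambda>b. z b + t * of_bool (b = a)"] unfolding expand expandP L_def K_def
      by (simp add: algebra_simps)
    have "L = 0"
    proof (rule ccontr)
      assume "L \<noteq> 0"
      \<comment> \<open>At \<open>t = - L / m\<close> the expression in \<open>key\<close> is
        \<open>L^2 / m * (K / m - 2)\<close>, and \<open>K < m\<close> makes it negative. The
        summand 1 keeps \<open>m\<close> positive when \<open>K = 0\<close>.\<close>
      define m where "m = 1 + \<bar>K\<bar>"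
      have m: "m > 0" "K < m" by (auto simp: m_def)
      have "0 \<le> 2 * (- L / m) * L + (- L / m)\<^sup>2 * K" by (rule key)
      also have "\<dots> = L\<^sup>2 / m * (K / m - 2)"
        using m by (simp add: field_simps power2_eq_square)
      also have "\<dots> < 0"
      proof -
        have "K / m - 2 < 0" using m by (simp add: field_simps)
        moreover have "L\<^sup>2 / m > 0" using m \<open>L \<noteq> 0\<close> by simp
        ultimately show ?thesis by (rule mult_pos_neg[rotated])
      qed
      finally show False by simp
    qed
    then show ?thesis by (simp add: L_def)
  qed
  moreover have "\<exists>a\<in>S. z a \<noteq> 0"
    using Pz by (auto simp: P_def intro: ccontr)
  ultimately have "0 \<le> Q z" using eig by blast
  then have "0 \<le> Q z * P x" by (simp add: P_def sum_nonneg)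
  with Q_ge[of x] show ?thesis by (simp add: Q_def)
qed simp

subsection \<open>Counting subspaces\<close>

locale finite_field_vector_space = finite_dimensional_vector_space scale Basis
  for scale :: "'f::{field,finite} \<Rightarrow> 'v::ab_group_add \<Rightarrow> 'v" (infixr \<open>\<odot>\<close> 75)
    and Basis :: "'v set" +
  fixes q n :: nat
  assumes q_eq: "q = CARD('f)" and n_eq: "n = dim (UNIV :: 'v set)"
begin

abbreviation Gr :: "nat \<Rightarrow> 'v set set" where "Gr \<equiv> subspaces_of_dim scale"

lemma Gr_iff: "A \<in> Gr k \<longleftrightarrow> subspace A \<and> dim A = k"
  by (simp add: subspaces_of_dim_def)

lemma Gr_zero: "B \<in> Gr k \<Longrightarrow> 0 \<in> B"
  using subspace_0 by (simp add: Gr_iff)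

lemma q_ge_2: "2 \<le> q"
proof -
  have "card {0::'f, 1} \<le> q" unfolding q_eq by (intro card_mono) auto
  then show ?thesis by simp
qed

text \<open>Adding an independent vector \<open>v\<close> multiplies the size of the span by
  \<open>q\<close>, because the representation \<open>c v + s\<close> with \<open>s\<close> in the
  old span is unique.\<close>

lemma card_span_eq_power:
  assumes "independent B"
  shows "finite (span B) \<and> card (span B) = q ^ card B"
proof -
  have "finite B" using assms by (rule finiteI_independent)
  then show ?thesis using assms
  proof (induction B rule: finite_induct)
    case (insert v B)
    then have ind: "independent B" "v \<notin> span B" by (auto simp: independent_insert split: if_splits)
    have eq: "span (insert v B) = (\<lambda>(c, s). c \<odot> v + s) ` (UNIV \<times> span B)"
    proof -
      have "x \<in> (\<lambda>(c, s). c \<odot> v + s) ` (UNIV \<times> span B)" if "x - c \<odot> v \<in> span B" for x c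
        using that by (intro image_eqI[of _ _ "(c, x - c \<odot> v)"]) auto
      moreover have "\<exists>d. c \<odot> v + s - d \<odot> v \<in> span B" if "s \<in> span B" for c s
        using that by (intro exI[of _ c]) simp
      ultimately show ?thesis by (auto simp: span_breakdown_eq)
    qed
    have "inj_on (\<lambda>(c, s). c \<odot> v + s) (UNIV \<times> span B)"
    proof (clarsimp simp: inj_on_def)
      fix c s d t assume st: "s \<in> span B" "t \<in> span B" and e: "c \<odot> v + s = d \<odot> v + t"
      have "(c - d) \<odot> v = t - s" using e by (simp add: algebra_simps)
      also have "\<dots> \<in> span B" using st by (rule span_diff[rotated])
      finally have "(c - d) \<odot> v \<in> span B" .
      then have "c = d" using ind(2) span_scale[of "(c - d) \<odot> v" B "inverse (c - d)"]
        by (cases "c = d") auto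
      with e show "c = d \<and> s = t" by simp
    qed
    then show ?case
      using insert ind by (simp add: eq card_image q_eq card_cartesian_product)
  qed simp
qed

lemma finite_UNIV_space: "finite (UNIV :: 'v set)"
proof -
  have "finite (span Basis)"
    using card_span_eq_power[OF independent_Basis] by (rule conjunct1)
  then show ?thesis
    by (simp only: span_Basis)
qed

lemma finite_vectors [simp]: "finite (A :: 'v set)"
  using finite_UNIV_space by (rule finite_subset[rotated]) simp

lemma finite_Gr [simp]: "finite (Gr k)"
proof (rule finite_subset)
  show "finite (Pow (UNIV :: 'v set))"
    by (simp only: finite_Pow_iff finite_UNIV_space)
qed auto

lemma card_subspace: "subspace A \<Longrightarrow> card A = q ^ dim A"
  using basis_exists[of A] card_span_eq_power span_subspace by metis

abbreviation adjoin :: "'v \<Rightarrow> 'v set \<Rightarrow> 'v set" where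
  "adjoin v A \<equiv> span (insert v A)"

lemma mem_adjoin: "subspace A \<Longrightarrow> x \<in> adjoin v A \<longleftrightarrow> (\<exists>c. x - c \<odot> v \<in> A)"
  by (simp only: span_breakdown_eq span_eq_iff[THEN iffD2])

lemma adjoin_subset_iff: "subspace B \<Longrightarrow> adjoin v A \<subseteq> B \<longleftrightarrow> v \<in> B \<and> A \<subseteq> B"
  by (meson insert_subset span_minimal span_superset subset_trans)

lemma Gr_adjoin_subset_iff: "B \<in> Gr k \<Longrightarrow> adjoin v A \<subseteq> B \<longleftrightarrow> v \<in> B \<and> A \<subseteq> B"
  by (simp only: Gr_iff adjoin_subset_iff)

lemma dim_adjoin: "subspace A \<Longrightarrow> v \<notin> A \<Longrightarrow> dim (insert v A) = Suc (dim A)"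
  by (simp add: dim_insert span_eq_iff[THEN iffD2])

lemma scale_mem_iff: "subspace A \<Longrightarrow> c \<noteq> 0 \<Longrightarrow> c \<odot> v \<in> A \<longleftrightarrow> v \<in> A"
  using subspace_scale[of A "c \<odot> v" "inverse c"] subspace_scale[of A v c] by auto

text \<open>A vector of \<open>A\<close> with a nonzero \<open>v\<close>-component modulo
  \<open>J\<close> would put a multiple of \<open>v\<close>, hence \<open>v\<close> itself, into
  \<open>J + A\<close>.\<close>

lemma adjoin_Int_eq_zero:
  assumes J: "subspace J" and A: "subspace A" and JA: "J \<inter> A = {0}"
    and v: "v \<notin> {x + y | x y. x \<in> J \<and> y \<in> A}"
  shows "adjoin v J \<inter> A = {0}"
proof -
  have "x = 0" if "x \<in> A" "x - c \<odot> v \<in> J" for x c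
  proof (cases "c = 0")
    case True
    then show ?thesis using that JA by auto
  next
    case False
    have "c \<odot> v = - (x - c \<odot> v) + x" by simp
    then have "c \<odot> v \<in> {x + y | x y. x \<in> J \<and> y \<in> A}"
      using that subspace_neg[OF J] by blast
    then show ?thesis
      using v scale_mem_iff[OF subspace_sums[OF J A] False] by blast
  qed
  then show ?thesis
    by (auto simp: mem_adjoin[OF J] subspace_0[OF A]) (metis J diff_0 scale_zero_left subspace_0 minus_zero)
qed

lemma sum_count_swap:
  fixes f :: "'v set \<Rightarrow> real"
  assumes "finite S"
  shows "(\<Sum>v\<in>T. \<Sum>B | B \<in> S \<and> v \<in> B. f B) = (\<Sum>B\<in>S. f B * real (card (B \<inter> T)))"
proof -
  have "(\<Sum>v\<in>T. \<Sum>B | B \<in> S \<and> v \<in> B. f B) = (\<Sum>v\<in>T. \<Sum>B\<in>S. if v \<in> B then f B else 0)"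
    using assms by (simp add: sum.inter_filter)
  also have "\<dots> = (\<Sum>B\<in>S. \<Sum>v\<in>T. if v \<in> B then f B else 0)"
    by (rule sum.swap)
  also have "\<dots> = (\<Sum>B\<in>S. f B * real (card (B \<inter> T)))"
    by (intro sum.cong refl) (simp add: sum.inter_filter[symmetric] Int_def conj_commute mult.commute)
  finally show ?thesis .
qed

text \<open>The number of \<open>k\<close>-spaces that contain a given \<open>j\<close>-space and
  meet a given \<open>a\<close>-space trivially, when these two meet trivially and
  \<open>j <= k\<close>. For \<open>a = 0\<close> and \<open>k <= n\<close> it is the Gaussian
  binomial coefficient of \<open>n - j\<close> over \<open>k - j\<close>. For \<open>j > k\<close>
  the empty product gives 1, although there is no such space.\<close>

definition num_ext :: "nat \<Rightarrow> nat \<Rightarrow> nat \<Rightarrow> real" where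
  "num_ext k a j = (\<Prod>i=j..<k. (real q ^ n - real q ^ (a + i)) / (real q ^ k - real q ^ i))"

lemma num_ext_rec:
  assumes "j < k"
  shows "num_ext k a j * (real q ^ k - real q ^ j) = (real q ^ n - real q ^ (a + j)) * num_ext k a (Suc j)"
proof -
  have "real q ^ k - real q ^ j \<noteq> 0"
    using assms q_ge_2 by simp
  then show ?thesis
    using assms by (simp add: num_ext_def prod.atLeast_Suc_lessThan)
qed

text \<open>Double counting of the pairs \<open>(v, B)\<close> with \<open>v \<in> B - J\<close>: each \<open>B\<close> occurs \<open>q ^ k - q ^ j\<close>
  times, and \<open>v\<close> can be extended iff it lies outside \<open>J + A\<close>.\<close>
lemma card_extensions:
  assumes "subspace A" "subspace J" "J \<inter> A = {0}" "dim J \<le> k"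
  shows "real (card {B \<in> Gr k. J \<subseteq> B \<and> B \<inter> A = {0}}) = num_ext k (dim A) (dim J)"
proof -
  define num where "num J = real (card {B \<in> Gr k. B \<inter> A = {0} \<and> J \<subseteq> B})" for J
  \<comment> \<open>The induction descends from \<open>j = k\<close>, where \<open>J\<close> is its
    own only extension.\<close>
  have "num J = num_ext k (dim A) j"
    if "j \<le> k" "subspace J" "J \<inter> A = {0}" "dim J = j" for j J
    using that
  proof (induction j arbitrary: J rule: inc_induct)
    case base
    have "B = J" if "B \<in> Gr k" "J \<subseteq> B" for B
      using base that subspace_dim_equal[of J B] by (auto simp: Gr_iff)
    then have "{B \<in> Gr k. B \<inter> A = {0} \<and> J \<subseteq> B} = {J}"
      using base by (auto simp: Gr_iff)
    then show ?case by (simp add: num_ext_def num_def)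
  next
    case (step j)
    define S where "S = {B \<in> Gr k. B \<inter> A = {0} \<and> J \<subseteq> B}"
    define JA where "JA = {x + y | x y. x \<in> J \<and> y \<in> A}"
    have sub_JA: "subspace JA" unfolding JA_def using step.prems assms(1) by (intro subspace_sums)
    have "dim JA + dim (J \<inter> A) = dim J + dim A"
      unfolding JA_def using step.prems assms(1) by (intro dim_sums_Int)
    then have dim_JA: "dim JA = dim A + j" using step.prems by simp
    have J_JA: "J \<subseteq> JA" unfolding JA_def using subspace_0[OF assms(1)] by force
    have count_v: "real (card {B \<in> S. v \<in> B}) = (if v \<in> JA then 0 else num_ext k (dim A) (Suc j))"
      if v: "v \<in> - J" for v
    proof (cases "v \<in> JA")
      case True
      then obtain x y where xy: "v = x + y" "x \<in> J" "y \<in> A" by (auto simp: JA_def)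
      have "v \<notin> B" if "B \<in> S" for B
      proof
        assume "v \<in> B"
        then have "y \<in> B"
          using that xy subspace_diff[of B v x] by (auto simp: S_def Gr_iff)
        then have "y = 0" using that xy by (auto simp: S_def)
        with xy v show False by simp
      qed
      then have "{B \<in> S. v \<in> B} = {}" by blast
      then have "card {B \<in> S. v \<in> B} = 0" by (simp only: card.empty)
      with True show ?thesis by simp
    next
      case False
      have "{B \<in> S. v \<in> B} = {B \<in> Gr k. B \<inter> A = {0} \<and> adjoin v J \<subseteq> B}"
        unfolding S_def using Gr_adjoin_subset_iff[of _ k v J] by blast
      moreover have "num (adjoin v J) = num_ext k (dim A) (Suc j)"
      proof (rule step.IH)
        show "adjoin v J \<inter> A = {0}"
          using step.prems False assms(1) unfolding JA_def by (intro adjoin_Int_eq_zero)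
        show "dim (adjoin v J) = Suc j"
          using step.prems v by (simp add: dim_adjoin)
      qed (rule subspace_span)
      ultimately show ?thesis using False by (simp add: num_def)
    qed
    have "num J * (real q ^ k - real q ^ j) = (\<Sum>B\<in>S. 1 * real (card (B \<inter> - J)))"
    proof -
      have "real (card (B \<inter> - J)) = real q ^ k - real q ^ j" if "B \<in> S" for B
        using that step.prems card_Diff_subset[of J B] card_mono[of B J]
        by (simp add: S_def Gr_iff card_subspace Diff_eq[symmetric] of_nat_diff)
      then show ?thesis by (simp add: num_def S_def[symmetric])
    qed
    also have "\<dots> = (\<Sum>v\<in>-J. \<Sum>B | B \<in> S \<and> v \<in> B. 1)"
      by (rule sum_count_swap[symmetric]) (simp add: S_def)
    also have "\<dots> = (\<Sum>v\<in>-J. if v \<in> JA then 0 else num_ext k (dim A) (Suc j))"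
      using count_v by (intro sum.cong) auto
    also have "\<dots> = (\<Sum>v\<in>-JA. num_ext k (dim A) (Suc j))"
      using J_JA by (intro sum.mono_neutral_cong_right) auto
    also have "\<dots> = (real q ^ n - real q ^ (dim A + j)) * num_ext k (dim A) (Suc j)"
      using card_Diff_subset[of JA UNIV] card_mono[of UNIV JA] card_subspace[OF sub_JA]
        card_subspace[OF subspace_UNIV]
      by (simp add: dim_JA n_eq Compl_eq_Diff_UNIV of_nat_diff del: dim_UNIV)
    also have "\<dots> = num_ext k (dim A) j * (real q ^ k - real q ^ j)"
      using step.hyps by (simp add: num_ext_rec)
    finally show ?case
      using step.hyps q_ge_2 by simp
  qed
  from this[of "dim J" J] assms show ?thesis
    by (simp add: num_def conj_commute)
qed

lemma obtain_hyperplane: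
  assumes "subspace J" "dim J = Suc m"
  obtains J' where "subspace J'" "J' \<subseteq> J" "dim J' = m"
proof -
  obtain B where B: "B \<subseteq> J" "independent B" "J \<subseteq> span B" "card B = Suc m"
    using basis_exists[of J] assms(2) by metis
  then obtain b where b: "b \<in> B" by fastforce
  have "independent (B - {b})" using B(2) independent_mono by blast
  then have "dim (span (B - {b})) = m"
    using B b by (simp add: dim_eq_card_independent finiteI_independent)
  moreover have "span (B - {b}) \<subseteq> J"
    using assms(1) B(1) by (intro span_minimal) auto
  ultimately show ?thesis using that by blast
qed

lemma subspace_zero: "subspace {0}"
  using subspace_span[of "{}"] by simp

lemma dim_zero: "dim {0} = 0"
  by simp

lemma Gr_Int_zero: "B \<in> Gr k \<Longrightarrow> B \<inter> {0} = {0}"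
  using subspace_0 by (auto simp: Gr_iff)

lemma card_containing:
  assumes "subspace J" "dim J \<le> k"
  shows "real (card {B \<in> Gr k. J \<subseteq> B}) = num_ext k 0 (dim J)"
proof -
  have "J \<inter> {0} = {0}" using subspace_0[OF assms(1)] by simp
  then have "real (card {B \<in> Gr k. J \<subseteq> B \<and> B \<inter> {0} = {0}}) = num_ext k 0 (dim J)"
    using card_extensions[OF subspace_zero assms(1) _ assms(2)] by (simp only: dim_zero)
  then show ?thesis
    by (simp add: Gr_Int_zero cong: conj_cong)
qed

lemma card_Gr: "real (card (Gr k)) = num_ext k 0 0"
proof -
  have "{B \<in> Gr k. {0} \<subseteq> B} = Gr k"
    using subspace_0 by (auto simp: Gr_iff)
  then show ?thesis
    using card_containing[OF subspace_zero, of k] by (simp only: dim_zero)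
qed

text \<open>The line and the point span a plane, and \<open>num_ext_rec\<close> turns the count
  \<open>num_ext k 0 2\<close> into this quotient. The quotient form also covers
  \<open>k = 1\<close>: its numerator vanishes there, whereas \<open>num_ext 1 0 2\<close> is
  1.\<close>

lemma card_containing_line_point:
  assumes "subspace J" "dim J = 1" "v \<notin> J" "1 \<le> k" "2 \<le> n"
  shows "real (card {B \<in> Gr k. J \<subseteq> B \<and> v \<in> B}) = num_ext k 0 1 * (real q ^ k - real q) / (real q ^ n - real q)"
proof -
  have "{B \<in> Gr k. J \<subseteq> B \<and> v \<in> B} = {B \<in> Gr k. adjoin v J \<subseteq> B}"
    by (simp add: Gr_adjoin_subset_iff conj_ac cong: conj_cong)
  moreover have d: "dim (adjoin v J) = 2"
    using assms by (simp add: dim_adjoin)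
  moreover have "real q ^ n - real q \<noteq> 0"
    using assms q_ge_2 power_strict_increasing[of 1 n "real q"] by simp
  ultimately show ?thesis
  proof (cases "k = 1")
    case True
    have "\<not> adjoin v J \<subseteq> B" if "B \<in> Gr k" for B
    proof
      assume "adjoin v J \<subseteq> B"
      from dim_subset[OF this] that show False by (simp only: Gr_iff True d)
    qed
    then have "{B \<in> Gr k. adjoin v J \<subseteq> B} = {}"
      by auto
    then have "card {B \<in> Gr k. adjoin v J \<subseteq> B} = 0" by (simp only: card.empty)
    with \<open>{B \<in> Gr k. J \<subseteq> B \<and> v \<in> B} = _\<close> True show ?thesis by simp
  next
    case False
    then have "real (card {B \<in> Gr k. adjoin v J \<subseteq> B}) = num_ext k 0 2"
      using card_containing[of "adjoin v J" k] d assms(4) by (simp only: subspace_span)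
    moreover have "num_ext k 0 1 * (real q ^ k - real q) = (real q ^ n - real q) * num_ext k 0 2"
      using num_ext_rec[of 1 k 0] False assms(4) by (simp add: numeral_2_eq_2)
    ultimately show ?thesis
      using \<open>{B \<in> Gr k. J \<subseteq> B \<and> v \<in> B} = _\<close> \<open>real q ^ n - real q \<noteq> 0\<close>
      by (simp add: field_simps)
  qed
qed

lemma sum_count_swap_vectors:
  fixes f :: "'v \<Rightarrow> real"
  assumes "finite S"
  shows "(\<Sum>B\<in>S. \<Sum>v\<in>B. f v) = (\<Sum>v\<in>UNIV. f v * real (card {B \<in> S. v \<in> B}))"
proof -
  have "(\<Sum>B\<in>S. \<Sum>v\<in>B. f v) = (\<Sum>B\<in>S. \<Sum>v\<in>UNIV. if v \<in> B then f v else 0)"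
    by (intro sum.cong refl sum.mono_neutral_cong_left) auto
  also have "\<dots> = (\<Sum>v\<in>UNIV. \<Sum>B\<in>S. if v \<in> B then f v else 0)"
    by (rule sum.swap)
  also have "\<dots> = (\<Sum>v\<in>UNIV. f v * real (card {B \<in> S. v \<in> B}))"
    using assms by (intro sum.cong refl) (simp add: sum.inter_filter[symmetric] mult.commute)
  finally show ?thesis .
qed

lemma span_singleton_subset_iff: "B \<in> Gr k \<Longrightarrow> span {v} \<subseteq> B \<longleftrightarrow> v \<in> B"
  using Gr_adjoin_subset_iff[of B k v "{}"] by simp

subsection \<open>Kernels depending on the intersection\<close>

text \<open>A space meeting the hyperplane \<open>J'\<close> of \<open>J\<close> trivially meets \<open>J\<close> in at most a line, so the sum
  over the spaces avoiding \<open>J'\<close> splits into the sum over those avoiding \<open>J\<close> and, for every line of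
  \<open>J\<close> outside \<open>J'\<close>, the sum over those containing that line. This replaces Moebius inversion on the
  subspace lattice.\<close>
lemma sum_avoiding:
  fixes x :: "'v set \<Rightarrow> real"
  assumes van: "\<And>I. subspace I \<Longrightarrow> dim I < j \<Longrightarrow> (\<Sum>B | B \<in> Gr k \<and> I \<subseteq> B. x B) = 0"
    and "subspace I" "subspace J" "I \<inter> J = {0}" "dim I + dim J \<le> j"
  shows "(\<Sum>B | B \<in> Gr k \<and> I \<subseteq> B \<and> B \<inter> J = {0}. x B) =
    (if dim I + dim J = j
     then (- 1) ^ dim J * real q ^ (dim J choose 2) * (\<Sum>B | B \<in> Gr k \<and> I \<subseteq> B \<and> J \<subseteq> B. x B)
     else 0)"
  using assms(2-)
proof (induction "dim J" arbitrary: I J)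
  case 0
  have "J = {0}" using 0(1) subspace_0[OF 0(3)] dim_eq_0[of J] by auto
  moreover have "B \<inter> {0} = {0}" "{0} \<subseteq> B" if "B \<in> Gr k" for B
    using that subspace_0 by (auto simp: Gr_iff)
  ultimately have "(\<Sum>B | B \<in> Gr k \<and> I \<subseteq> B \<and> B \<inter> J = {0}. x B) = (\<Sum>B | B \<in> Gr k \<and> I \<subseteq> B. x B)"
    "(\<Sum>B | B \<in> Gr k \<and> I \<subseteq> B \<and> J \<subseteq> B. x B) = (\<Sum>B | B \<in> Gr k \<and> I \<subseteq> B. x B)"
    by (auto intro!: sum.cong)
  then show ?case
    using 0(1) van[OF 0(2)] 0(5) by (auto simp: 0(1)[symmetric] numeral_2_eq_2 simp del: dim_eq_0)
next
  case (Suc m)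
  have dJ: "dim J = Suc m" using Suc.hyps(2) by simp
  obtain J' where J': "subspace J'" "J' \<subseteq> J" "dim J' = m"
    using obtain_hyperplane[of J m] Suc by metis
  define Y where "Y I J = (\<Sum>B | B \<in> Gr k \<and> I \<subseteq> B \<and> B \<inter> J = {0}. x B)" for I J
  define W where "W = (\<Sum>B | B \<in> Gr k \<and> I \<subseteq> B \<and> J \<subseteq> B. x B)"
  define S where "S = {B \<in> Gr k. I \<subseteq> B \<and> B \<inter> J' = {0}}"
  have IJ': "I \<inter> J' = {0}"
    using Suc.prems J' subspace_0 by blast
  have card_S: "real (card (B \<inter> (J - J'))) = (if B \<inter> J = {0} then 0 else real q - 1)" if B: "B \<in> S" for B
  proof -
    have sB: "subspace B" and BJ': "B \<inter> J' = {0}" using B by (auto simp: S_def Gr_iff)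
    have sub: "subspace (B \<inter> J)" using sB Suc.prems by (intro subspace_inter)
    have "{y + z | y z. y \<in> B \<inter> J \<and> z \<in> J'} \<subseteq> J"
      using J'(2) by (auto intro!: subspace_add[OF Suc.prems(2)])
    from dim_subset[OF this] have "dim {y + z | y z. y \<in> B \<inter> J \<and> z \<in> J'} \<le> Suc m"
      by (simp only: dJ)
    moreover have "dim {y + z | y z. y \<in> B \<inter> J \<and> z \<in> J'} + dim (B \<inter> J \<inter> J') = dim (B \<inter> J) + dim J'"
      using sub J' by (intro dim_sums_Int)
    moreover have "B \<inter> J \<inter> J' = {0}" using BJ' subspace_0[OF sub] subspace_0[OF J'(1)] by blast
    then have "dim (B \<inter> J \<inter> J') = 0" by (simp only: dim_singleton simp_thms if_True)
    ultimately have le: "dim (B \<inter> J) \<le> 1" using J'(3) by linarith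
    have zero: "0 \<in> B \<inter> J" using sub by (rule subspace_0)
    have "card (B \<inter> (J - J')) = card (B \<inter> J - {0})"
      using BJ' by (intro arg_cong[of _ _ card]) blast
    also have "\<dots> = q ^ dim (B \<inter> J) - 1"
      using zero by (simp only: card_Diff_singleton card_subspace[OF sub])
    finally have card: "card (B \<inter> (J - J')) = q ^ dim (B \<inter> J) - 1" .
    show ?thesis
    proof (cases "B \<inter> J = {0}")
      case True
      then have "dim (B \<inter> J) = 0" by (simp only: dim_singleton simp_thms if_True)
      with card True show ?thesis by simp
    next
      case False
      then have "dim (B \<inter> J) \<noteq> 0" using zero by (subst dim_eq_0) blast
      with le have "dim (B \<inter> J) = 1" by linarith
      with card False show ?thesis using q_ge_2 by (simp add: of_nat_diff)
    qed
  qed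
  have "{B \<in> S. B \<inter> J = {0}} = {B. B \<in> Gr k \<and> I \<subseteq> B \<and> B \<inter> J = {0}}"
  proof -
    have "B \<inter> J' = {0}" if "B \<inter> J = {0}" for B
      using that J'(2) subspace_0[OF J'(1)] by blast
    then show ?thesis by (auto simp: S_def)
  qed
  moreover have "(\<Sum>B\<in>S. if B \<inter> J = {0} then x B else 0) = (\<Sum>B\<in>{B \<in> S. B \<inter> J = {0}}. x B)"
    by (rule sum.inter_filter[symmetric]) (simp add: S_def)
  ultimately have Y_eq: "(\<Sum>B\<in>S. if B \<inter> J = {0} then x B else 0) = Y I J"
    by (simp only: Y_def)
  have "(\<Sum>v\<in>J - J'. Y (adjoin v I) J') = (\<Sum>v\<in>J - J'. \<Sum>B | B \<in> S \<and> v \<in> B. x B)"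
    unfolding Y_def S_def by (simp add: Gr_adjoin_subset_iff conj_ac cong: conj_cong)
  also have "\<dots> = (\<Sum>B\<in>S. x B * real (card (B \<inter> (J - J'))))"
    by (rule sum_count_swap) (simp add: S_def)
  also have "\<dots> = (\<Sum>B\<in>S. (real q - 1) * (x B - (if B \<inter> J = {0} then x B else 0)))"
    by (intro sum.cong) (auto simp: card_S)
  also have "\<dots> = (real q - 1) * (Y I J' - (\<Sum>B\<in>S. if B \<inter> J = {0} then x B else 0))"
    by (simp add: sum_distrib_left[symmetric] sum_subtractf Y_def S_def)
  finally have split: "(\<Sum>v\<in>J - J'. Y (adjoin v I) J') = (real q - 1) * (Y I J' - Y I J)"
    by (simp only: Y_eq)
  \<comment> \<open>Since \<open>dim J' = dim J - 1\<close>, the pair \<open>I\<close>,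
    \<open>J'\<close> has total dimension below \<open>j\<close>, where the induction hypothesis
    gives zero.\<close>
  have "Y I J' = 0"
    using Suc.hyps(1)[of J' I] dJ Suc.prems J' IJ' by (simp add: Y_def)
  \<comment> \<open>Moving \<open>v\<close> from \<open>J\<close> to \<open>I\<close> preserves the
    total dimension. As \<open>adjoin v J' = J\<close>, the spaces containing
    \<open>adjoin v I\<close> and \<open>J'\<close> are those containing \<open>I\<close> and
    \<open>J\<close>, so the same \<open>W\<close> appears for every \<open>v\<close>.\<close>
  moreover have "Y (adjoin v I) J' = (if dim I + dim J = j then (- 1) ^ m * real q ^ (m choose 2) * W else 0)"
    if v: "v \<in> J - J'" for v
  proof -
    have "v \<notin> I"
    proof
      assume "v \<in> I"
      then have "v \<in> I \<inter> J" using v by simp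
      then have "v = 0" by (simp only: Suc.prems(3) singleton_iff)
      then show False using v subspace_0[OF J'(1)] by simp
    qed
    then have dim_v: "dim (adjoin v I) = Suc (dim I)"
      using Suc.prems by (simp add: dim_adjoin)
    have "adjoin v I \<inter> J' = {0}"
    proof (intro adjoin_Int_eq_zero IJ' Suc.prems J' notI)
      assume "v \<in> {y + z | y z. y \<in> I \<and> z \<in> J'}"
      then obtain y z where yz: "v = y + z" "y \<in> I" "z \<in> J'" by blast
      have "y = v - z" using yz by simp
      then have "y \<in> J" using v yz J' subspace_diff[OF Suc.prems(2)] by blast
      then have "y \<in> I \<inter> J" using yz by simp
      then have "y = 0" by (simp only: Suc.prems(3) singleton_iff)
      then show False using yz v by simp
    qed
    moreover have "adjoin v J' = J"
    proof (rule subspace_dim_equal)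
      show "adjoin v J' \<subseteq> J" using v J' Suc.prems by (simp add: adjoin_subset_iff)
      show "dim J \<le> dim (adjoin v J')" using v J' dJ by (simp add: dim_adjoin)
    qed (use Suc.prems in auto)
    then have "J \<subseteq> B \<longleftrightarrow> v \<in> B \<and> J' \<subseteq> B" if "B \<in> Gr k" for B
      using Gr_adjoin_subset_iff[OF that, of v J'] by simp
    then have "{B. B \<in> Gr k \<and> adjoin v I \<subseteq> B \<and> J' \<subseteq> B} = {B. B \<in> Gr k \<and> I \<subseteq> B \<and> J \<subseteq> B}"
      by (simp add: Gr_adjoin_subset_iff conj_ac cong: conj_cong)
    ultimately show ?thesis
      using Suc.hyps(1)[of J' "adjoin v I"] dJ Suc.prems J' dim_v
      by (simp add: Y_def W_def)
  qed
  moreover have "real (card (J - J')) = real q ^ m * (real q - 1)"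
    using J' Suc.prems card_mono[of J J']
    by (simp add: card_Diff_subset card_subspace of_nat_diff algebra_simps dJ)
  ultimately have "(real q - 1) * (- Y I J) = (real q - 1) *
      (real q ^ m * (if dim I + dim J = j then (- 1) ^ m * real q ^ (m choose 2) * W else 0))"
    using split by (simp add: mult_ac)
  then have "- Y I J = real q ^ m * (if dim I + dim J = j then (- 1) ^ m * real q ^ (m choose 2) * W else 0)"
    by (rule mult_left_cancel[THEN iffD1, rotated]) (use q_ge_2 in simp)
  \<comment> \<open>The factor \<open>q ^ m\<close>, left from the number of vectors in
    \<open>J - J'\<close> after cancelling \<open>q - 1\<close>, supplies the growth of the
    exponent.\<close>
  moreover have "Suc m choose 2 = m + (m choose 2)"
    by (simp add: numeral_2_eq_2)
  ultimately have "Y I J = (if dim I + dim J = j then (- 1) ^ Suc m * real q ^ (Suc m choose 2) * W else 0)"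
    by (cases "dim I + dim J = j") (auto simp: power_add mult_ac)
  then show ?case
    by (simp only: Y_def W_def dJ)
qed

text \<open>For an eigenvector \<open>x\<close>, the least \<open>j\<close> such that the sum of \<open>x\<close> over the \<open>k\<close>-spaces containing some
  \<open>j\<close>-space \<open>J\<close> does not vanish determines the eigenvalue: sum the eigenvalue equation over the
  \<open>k\<close>-spaces containing \<open>J\<close>. The right-hand sides in \<open>h0\<close>, \<open>h1\<close> and \<open>hj\<close> are the eigenvalues for \<open>j = 0\<close>,
  \<open>j = 1\<close> and \<open>j \<ge> 2\<close>. The quotient in \<open>h1\<close> is \<open>num_ext k 0 2\<close> if \<open>k \<ge> 2\<close>, but correctly \<open>0\<close> if \<open>k = 1\<close>.\<close>
lemma intersection_form_nonneg:
  fixes \<alpha> \<beta> \<gamma> \<psi> :: real and x :: "'v set \<Rightarrow> real"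
  defines "H \<equiv> \<lambda>A B. \<alpha> * of_bool (A = B) + \<beta> + \<gamma> * real q ^ dim (A \<inter> B) + \<psi> * of_bool (A \<inter> B = {0})"
  assumes k: "1 \<le> k" "k \<le> n" and n: "2 \<le> n"
    and h0: "0 \<le> \<alpha> + \<beta> * num_ext k 0 0 + \<gamma> * (num_ext k 0 0 + (real q ^ k - 1) * num_ext k 0 1) + \<psi> * num_ext k k 0"
    and h1: "0 \<le> \<alpha> + \<gamma> * ((real q - 1) * (num_ext k 0 1 - num_ext k 0 1 * (real q ^ k - real q) / (real q ^ n - real q)))
                - \<psi> * num_ext k k 1"
    and hj: "\<And>j. 2 \<le> j \<Longrightarrow> j \<le> k \<Longrightarrow> 0 \<le> \<alpha> + \<psi> * ((- 1) ^ j * real q ^ (j choose 2) * num_ext k k j)"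
  shows "0 \<le> (\<Sum>A\<in>Gr k. \<Sum>B\<in>Gr k. H A B * x A * x B)"
proof (rule quadratic_form_nonneg_if_eigenvalues_nonneg)
  show "H A B = H B A" for A B
    by (auto simp: H_def Int_commute)
next
  fix \<theta> x
  assume nz: "\<exists>A\<in>Gr k. x A \<noteq> 0" and eig: "\<forall>A\<in>Gr k. (\<Sum>B\<in>Gr k. H A B * x B) = \<theta> * x A"
  define W where "W J = (\<Sum>B | B \<in> Gr k \<and> J \<subseteq> B. x B)" for J
  define R where "R j \<longleftrightarrow> (\<exists>J. subspace J \<and> dim J = j \<and> W J \<noteq> 0)" for j
  define j where "j = (LEAST j. R j)"
  obtain A0 where A0: "A0 \<in> Gr k" "x A0 \<noteq> 0" using nz by blast
  \<comment> \<open>No other \<open>k\<close>-space contains \<open>A0\<close>, so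
    \<open>W A0 = x A0\<close> is nonzero. Hence the least \<open>j\<close> exists and is at most
    \<open>k\<close>.\<close>
  have "B = A0" if "B \<in> Gr k" "A0 \<subseteq> B" for B
    using A0 that subspace_dim_equal[of A0 B] by (simp add: Gr_iff)
  then have "{B. B \<in> Gr k \<and> A0 \<subseteq> B} = {A0}"
    using A0 by blast
  then have "W A0 = x A0" by (simp add: W_def)
  then have Rk: "R k" using A0 by (auto simp: R_def Gr_iff)
  have jk: "j \<le> k" unfolding j_def using Rk by (rule Least_le)
  have "R j" unfolding j_def using Rk by (rule LeastI)
  then obtain J where J: "subspace J" "dim J = j" "W J \<noteq> 0" by (auto simp: R_def)
  have van: "W I = 0" if "subspace I" "dim I < j" for I
  proof -
    have "\<not> R (dim I)" using that(2) unfolding j_def by (rule not_less_Least)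
    then show ?thesis using that(1) unfolding R_def by blast
  qed
  define T where "T = {A \<in> Gr k. J \<subseteq> A}"
  have finT: "finite T" by (simp add: T_def)
  have cardT: "real (card T) = num_ext k 0 j"
    using card_containing[OF J(1)] J(2) jk by (simp add: T_def)
  define U where "U v = (\<Sum>B | B \<in> Gr k \<and> v \<in> B. x B)" for v
  have U_W: "U v = W (span {v})" for v
    unfolding U_def W_def by (simp add: span_singleton_subset_iff cong: conj_cong)
  have W0: "W {0} = (\<Sum>B\<in>Gr k. x B)"
    unfolding W_def by (simp add: Gr_zero cong: conj_cong)
  define G where "G = (\<Sum>A\<in>T. \<Sum>B\<in>Gr k. x B * real q ^ dim (A \<inter> B))"
  \<comment> \<open>The number \<open>q ^ dim (A \<inter> B)\<close> counts the vectors common to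
    \<open>A\<close> and \<open>B\<close>; exchanging sums leaves a sum over single vectors, and
    only subspaces of dimension at most 1 enter through \<open>U\<close>.\<close>
  have G_eq: "G = (\<Sum>v\<in>UNIV. U v * real (card {A \<in> T. v \<in> A}))"
  proof -
    have "(\<Sum>B\<in>Gr k. x B * real q ^ dim (A \<inter> B)) = (\<Sum>v\<in>A. U v)" if "A \<in> T" for A
    proof -
      have "real q ^ dim (A \<inter> B) = real (card (B \<inter> A))" if "B \<in> Gr k" for B
        using \<open>A \<in> T\<close> that card_subspace[OF subspace_inter[of A B]]
        by (simp add: T_def Gr_iff Int_commute)
      then have "(\<Sum>B\<in>Gr k. x B * real q ^ dim (A \<inter> B)) = (\<Sum>B\<in>Gr k. x B * real (card (B \<inter> A)))"
        by (intro sum.cong refl) (simp only:)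
      also have "\<dots> = (\<Sum>v\<in>A. U v)"
        unfolding U_def by (rule sum_count_swap[symmetric]) simp
      finally show ?thesis .
    qed
    then show ?thesis
      unfolding G_def by (simp add: sum_count_swap_vectors[OF finT, symmetric])
  qed
  have sum_U: "(\<Sum>v\<in>UNIV. U v) = real q ^ k * W {0}"
  proof -
    have "(\<Sum>v\<in>UNIV. U v) = (\<Sum>B\<in>Gr k. x B * real (card (B \<inter> UNIV)))"
      unfolding U_def by (rule sum_count_swap) simp
    also have "\<dots> = (\<Sum>B\<in>Gr k. x B * real q ^ k)"
      by (intro sum.cong refl) (simp add: Gr_iff card_subspace)
    finally show ?thesis by (simp add: W0 sum_distrib_left mult.commute)
  qed
  \<comment> \<open>Taking \<open>I = {0}\<close> in \<open>sum_avoiding\<close> gives its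
    borderline case \<open>dim I + dim J = j\<close>, with the vanishing below \<open>j\<close>
    supplied by minimality.\<close>
  have avoid: "(\<Sum>B | B \<in> Gr k \<and> B \<inter> J = {0}. x B) = (- 1) ^ j * real q ^ (j choose 2) * W J"
  proof -
    have "{0} \<subseteq> B" if "B \<in> Gr k" for B
      using that by (simp add: Gr_zero)
    moreover have "(\<Sum>B | B \<in> Gr k \<and> {0} \<subseteq> B \<and> B \<inter> J = {0}. x B) =
      (if dim {0} + dim J = j
       then (- 1) ^ dim J * real q ^ (dim J choose 2) * (\<Sum>B | B \<in> Gr k \<and> {0} \<subseteq> B \<and> J \<subseteq> B. x B) else 0)"
      using van subspace_0[OF J(1)] J
      by (intro sum_avoiding subspace_zero) (auto simp: W_def)
    ultimately show ?thesis
      by (simp add: J W_def cong: conj_cong)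
  qed
  \<comment> \<open>If \<open>B\<close> meets \<open>J\<close> nontrivially, then so does every
    \<open>A\<close> containing \<open>J\<close> meet \<open>B\<close>; otherwise
    \<open>card_extensions\<close> counts the spaces \<open>A\<close> avoiding
    \<open>B\<close>.\<close>
  have disj: "(\<Sum>A\<in>T. of_bool (A \<inter> B = {0})) = num_ext k k j * of_bool (B \<inter> J = {0})"
    if B: "B \<in> Gr k" for B
  proof (cases "B \<inter> J = {0}")
    case True
    then have "real (card {A \<in> Gr k. J \<subseteq> A \<and> A \<inter> B = {0}}) = num_ext k (dim B) (dim J)"
      using B J jk by (intro card_extensions) (auto simp: Gr_iff)
    moreover have "{A \<in> Gr k. J \<subseteq> A \<and> A \<inter> B = {0}} = T \<inter> {A. A \<inter> B = {0}}"
      by (auto simp: T_def)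
    ultimately show ?thesis
      using True B J finT by (simp add: Gr_iff)
  next
    case False
    moreover have "0 \<in> B \<inter> J" using Gr_zero[OF B] subspace_0[OF J(1)] by simp
    ultimately obtain y where y: "y \<in> B" "y \<in> J" "y \<noteq> 0" by blast
    have "A \<inter> B \<noteq> {0}" if "A \<in> T" for A
    proof
      assume "A \<inter> B = {0}"
      moreover have "y \<in> A \<inter> B" using that y by (auto simp: T_def)
      ultimately show False using y by simp
    qed
    then have "(\<Sum>A\<in>T. of_bool (A \<inter> B = {0})) = (\<Sum>A\<in>T. 0::real)"
      by (intro sum.cong) auto
    then show ?thesis using False by simp
  qed
  have "\<theta> * W J = (\<Sum>A\<in>T. \<Sum>B\<in>Gr k. H A B * x B)"
    using eig by (simp add: W_def T_def sum_distrib_left)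
  also have "\<dots> = (\<Sum>A\<in>T. (\<Sum>B\<in>Gr k. \<alpha> * of_bool (A = B) * x B) + \<beta> * W {0}
       + \<gamma> * (\<Sum>B\<in>Gr k. x B * real q ^ dim (A \<inter> B)) + \<psi> * (\<Sum>B\<in>Gr k. of_bool (A \<inter> B = {0}) * x B))"
    by (simp add: H_def W0 sum.distrib sum_distrib_left algebra_simps del: sum_mult_of_bool_eq sum_of_bool_mult_eq)
  also have "\<dots> = (\<Sum>A\<in>T. \<Sum>B\<in>Gr k. \<alpha> * of_bool (A = B) * x B) + real (card T) * \<beta> * W {0}
       + \<gamma> * G + \<psi> * (\<Sum>A\<in>T. \<Sum>B\<in>Gr k. of_bool (A \<inter> B = {0}) * x B)"
    by (simp add: G_def sum.distrib sum_distrib_left del: sum_mult_of_bool_eq sum_of_bool_mult_eq)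
  also have "(\<Sum>A\<in>T. \<Sum>B\<in>Gr k. \<alpha> * of_bool (A = B) * x B) = \<alpha> * W J"
  proof -
    have "(\<Sum>B\<in>Gr k. \<alpha> * of_bool (A = B) * x B) = \<alpha> * x A" if "A \<in> T" for A
    proof -
      have "(\<Sum>B\<in>Gr k. \<alpha> * of_bool (A = B) * x B) = (\<Sum>B\<in>Gr k. if A = B then \<alpha> * x B else 0)"
        by (intro sum.cong) auto
      then show ?thesis using that by (simp add: T_def)
    qed
    then show ?thesis by (simp add: W_def T_def sum_distrib_left)
  qed
  also have "(\<Sum>A\<in>T. \<Sum>B\<in>Gr k. of_bool (A \<inter> B = {0}) * x B) =
      num_ext k k j * ((- 1) ^ j * real q ^ (j choose 2) * W J)"
  proof -
    have "(\<Sum>A\<in>T. \<Sum>B\<in>Gr k. of_bool (A \<inter> B = {0}) * x B) =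
        (\<Sum>B\<in>Gr k. (\<Sum>A\<in>T. of_bool (A \<inter> B = {0})) * x B)"
      unfolding sum_distrib_right by (rule sum.swap)
    also have "\<dots> = num_ext k k j * (\<Sum>B\<in>Gr k. if B \<inter> J = {0} then x B else 0)"
      unfolding sum_distrib_left by (intro sum.cong refl) (simp only: disj, simp)
    also have "(\<Sum>B\<in>Gr k. if B \<inter> J = {0} then x B else 0) = (\<Sum>B | B \<in> Gr k \<and> B \<inter> J = {0}. x B)"
      by (rule sum.inter_filter[symmetric]) simp
    finally show ?thesis by (simp only: avoid)
  qed
  finally have main: "\<theta> * W J = \<alpha> * W J + num_ext k 0 j * \<beta> * W {0} + \<gamma> * G
      + \<psi> * (num_ext k k j * ((- 1) ^ j * real q ^ (j choose 2) * W J))"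
    by (simp only: cardT)
  consider "j = 0" | "j = 1" | "2 \<le> j" by linarith
  then show "0 \<le> \<theta>"
  proof cases
    case 1
    have J0: "J = {0}" using J 1 subspace_0[OF J(1)] dim_eq_0[of J] by auto
    have card_v: "real (card {A \<in> T. v \<in> A}) = num_ext k 0 1" if "v \<noteq> 0" for v
    proof -
      have "{A \<in> T. v \<in> A} = {A \<in> Gr k. span {v} \<subseteq> A}"
        by (simp add: T_def J0 span_singleton_subset_iff Gr_zero cong: conj_cong)
      then show ?thesis
        using card_containing[of "span {v}" k] that k by (simp add: subspace_span)
    qed
    have T0: "{A \<in> T. 0 \<in> A} = T" by (auto simp: T_def J0)
    have "G = U 0 * num_ext k 0 0 + (\<Sum>v\<in>UNIV - {0}. U v * num_ext k 0 1)"
      unfolding G_eq using cardT 1 by (subst sum.remove[of _ 0]) (simp_all add: T0 card_v)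
    also have "\<dots> = U 0 * num_ext k 0 0 + ((\<Sum>v\<in>UNIV. U v) - U 0) * num_ext k 0 1"
      by (simp add: sum_distrib_right[symmetric] sum_diff1)
    finally have "G = U 0 * num_ext k 0 0 + ((\<Sum>v\<in>UNIV. U v) - U 0) * num_ext k 0 1" .
    moreover have "U 0 = W {0}" by (simp add: U_W)
    ultimately have "G = W J * (num_ext k 0 0 + (real q ^ k - 1) * num_ext k 0 1)"
      by (simp add: sum_U J0 algebra_simps)
    with main have "\<theta> * W J = (\<alpha> + \<beta> * num_ext k 0 0 + \<gamma> * (num_ext k 0 0 + (real q ^ k - 1) * num_ext k 0 1)
        + \<psi> * num_ext k k 0) * W J"
      by (simp add: J0[symmetric] 1 numeral_2_eq_2 algebra_simps)
    then show ?thesis using J(3) h0 by simp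
  next
    case 2
    define c2 where "c2 = num_ext k 0 1 * (real q ^ k - real q) / (real q ^ n - real q)"
    have W00: "W {0} = 0" using van[OF subspace_zero] 2 by simp
    have card_v: "real (card {A \<in> T. v \<in> A}) = (if v \<in> J then num_ext k 0 1 else c2)" for v
    proof (cases "v \<in> J")
      case True
      then have "{A \<in> T. v \<in> A} = T" by (auto simp: T_def)
      then show ?thesis using True cardT 2 by simp
    next
      case False
      have "{A \<in> T. v \<in> A} = {A \<in> Gr k. J \<subseteq> A \<and> v \<in> A}" by (auto simp: T_def)
      then show ?thesis
        using card_containing_line_point[OF J(1) _ False] J(2) 2 k n False by (simp add: c2_def)
    qed
    have UJ: "U v = W J" if "v \<in> J - {0}" for v
    proof -
      have "span {v} = J"
        using that J 2 by (intro subspace_dim_equal) (auto simp: span_minimal)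
      then show ?thesis by (simp add: U_W)
    qed
    have U0: "U 0 = 0" by (simp add: U_W W00)
    have sumJ: "(\<Sum>v\<in>J. U v) = (real q - 1) * W J"
    proof -
      have "(\<Sum>v\<in>J. U v) = (\<Sum>v\<in>J - {0}. U v)"
        using U0 by (simp add: sum_diff1)
      also have "\<dots> = real (card (J - {0})) * W J"
        by (simp add: UJ)
      also have "real (card (J - {0})) = real q - 1"
        using J 2 subspace_0[OF J(1)] q_ge_2 by (simp add: card_subspace of_nat_diff)
      finally show ?thesis .
    qed
    \<comment> \<open>The values \<open>U v\<close> for \<open>v\<close> outside \<open>J\<close>
      are not known individually. Splitting off the constant count \<open>c2\<close> leaves them
      only in the full sum of \<open>U\<close>, which is a multiple of
      \<open>W {0} = 0\<close>.\<close>
    have "G = (\<Sum>v\<in>UNIV. c2 * U v + (if v \<in> J then (num_ext k 0 1 - c2) * U v else 0))"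
      unfolding G_eq by (intro sum.cong refl) (simp add: card_v algebra_simps)
    also have "\<dots> = c2 * (\<Sum>v\<in>UNIV. U v) + (\<Sum>v\<in>UNIV. if v \<in> J then (num_ext k 0 1 - c2) * U v else 0)"
      by (simp add: sum.distrib sum_distrib_left)
    also have "(\<Sum>v\<in>UNIV. if v \<in> J then (num_ext k 0 1 - c2) * U v else 0) = (num_ext k 0 1 - c2) * (\<Sum>v\<in>J. U v)"
      by (simp add: sum.If_cases sum_distrib_left finite_UNIV_space)
    finally have "G = (num_ext k 0 1 - c2) * ((real q - 1) * W J)"
      by (simp add: sum_U W00 sumJ)
    with main have "\<theta> * W J = (\<alpha> + \<gamma> * ((real q - 1) * (num_ext k 0 1 - c2)) - \<psi> * num_ext k k 1) * W J"
      by (simp add: W00 2 numeral_2_eq_2 algebra_simps)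
    then show ?thesis using J(3) h1 by (simp add: c2_def)
  next
    case 3
    \<comment> \<open>The span of one vector has dimension at most 1, hence below
      \<open>j\<close>.\<close>
    have "U v = 0" for v
      unfolding U_W using 3 by (intro van subspace_span) simp
    then have "G = 0" by (simp add: G_eq)
    moreover have "W {0} = 0" using van[OF subspace_zero] 3 by simp
    ultimately have "\<theta> * W J = (\<alpha> + \<psi> * ((- 1) ^ j * real q ^ (j choose 2) * num_ext k k j)) * W J"
      using main by (simp add: algebra_simps)
    then show ?thesis using J(3) hj[OF 3 jk] by simp
  qed
qed simp

end

subsection \<open>The choice of the kernel\<close>

text \<open>For \<open>q > 1\<close> this says that each of the \<open>d\<close> terms of the
  geometric sum \<open>q + ... + q ^ d\<close> is at most \<open>q ^ d\<close>.\<close>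

lemma power_sub_one_le:
  fixes q :: real
  assumes "1 \<le> q"
  shows "q * (q ^ d - 1) \<le> real d * ((q - 1) * q ^ d)"
proof (induction d)
  case (Suc d)
  have "q * (q ^ Suc d - 1) = q * (q * (q ^ d - 1)) + q * (q - 1)"
    by (simp add: algebra_simps)
  also have "\<dots> \<le> q * (real d * ((q - 1) * q ^ d)) + q ^ Suc d * (q - 1)"
  proof (intro add_mono mult_left_mono mult_right_mono Suc.IH)
    show "q \<le> q ^ Suc d"
      using assms one_le_power[of q d] mult_left_mono[of 1 "q ^ d" q] by simp
  qed (use assms in auto)
  also have "\<dots> = real (Suc d) * ((q - 1) * q ^ Suc d)"
    by (simp add: algebra_simps)
  finally show ?case .
qed simp

text \<open>The constant in front is scaled so that equality holds for \<open>s = k\<close> and for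
  \<open>s = k - 1\<close>.\<close>

lemma diff_ge_power_diff:
  fixes q :: real
  assumes "1 < q" "s \<le> k"
  shows "q / (q ^ k * (q - 1)) * (q ^ k - q ^ s) \<le> real k - real s"
proof -
  define d where "d = k - s"
  have k: "k = s + d" using assms by (simp add: d_def)
  have pos: "q ^ d > 0" "q - 1 > 0" "q ^ s > 0" using assms by auto
  have "q / (q ^ k * (q - 1)) * (q ^ k - q ^ s) = q * (q ^ d - 1) / ((q - 1) * q ^ d)"
    using pos by (simp add: k power_add divide_simps) (simp add: algebra_simps)
  also have "\<dots> \<le> real d"
    using power_sub_one_le[of q d] pos assms by (simp add: divide_le_eq)
  finally show ?thesis by (simp add: k)
qed

text \<open>In the identities of this group \<open>a\<close> and \<open>b\<close> stand for
  \<open>q ^ n\<close> and \<open>q ^ k\<close>, and \<open>ci\<close>, \<open>ei\<close> for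
  \<open>num_ext k 0 i\<close>, \<open>num_ext k k i\<close>. With \<psi> = 0 and \<gamma> = -
  \<open>q / (b * (q - 1))\<close>, the first summand is the value of \<alpha> for which the
  eigenvalue for \<open>j = 1\<close> vanishes.\<close>

lemma general_kernel_eigenvalue_1:
  fixes a b q :: real
  assumes "a - 1 \<noteq> 0" "a - q \<noteq> 0" "b \<noteq> 0" "q - 1 \<noteq> 0" "b - 1 \<noteq> 0" "c0 * (b - 1) = (a - 1) * c1"
  shows "q * c0 * (b - 1) * (a - b) / (b * (a - 1) * (a - q))
     + - (q / (b * (q - 1))) * ((q - 1) * (c1 - c1 * (b - q) / (a - q))) = 0"
proof -
  have "c0 = (a - 1) * c1 / (b - 1)" using assms by (simp add: field_simps)
  then show ?thesis using assms by (simp add: divide_simps) algebra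
qed

text \<open>With \<alpha> fixed by \<open>j = 1\<close>, the eigenvalue for \<open>j = 0\<close>
  determines \<beta>. It is written as \<kappa> \<open>b\<close> minus a number \<phi>, which later
  becomes the coefficient of \<open>M ^ 2\<close>.\<close>

lemma general_kernel_eigenvalue_0:
  fixes a b q :: real
  assumes "a - 1 \<noteq> 0" "a - q \<noteq> 0" "b \<noteq> 0" "q - 1 \<noteq> 0" "b - 1 \<noteq> 0" "c0 * (b - 1) = (a - 1) * c1"
  shows "q * c0 * (b - 1) * (a - b) / (b * (a - 1) * (a - q))
     + (q / (b * (q - 1)) * b - q * (b - 1) * (a - b) / (b * (q - 1) * (a - q))) * c0
     + - (q / (b * (q - 1))) * (c0 + (b - 1) * c1) = 0"
proof -
  have "c0 = (a - 1) * c1 / (b - 1)" using assms by (simp add: field_simps)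
  then show ?thesis using assms by (simp add: divide_simps) algebra
qed

text \<open>The eigenvalue for \<open>j = 2\<close> is \<alpha> + \<psi> \<open>q * e2\<close>, so
  its vanishing forces \<psi> = - \<alpha> / (\<open>q * e2\<close>). Solving the equation for
  \<open>j = 1\<close> under this constraint gives \<alpha>.\<close>

lemma disjointness_kernel_eigenvalue_1:
  fixes a b q :: real
  assumes "a - q \<noteq> 0" "b \<noteq> 0" "q - 1 \<noteq> 0" "b - q \<noteq> 0" "a - q ^ 2 \<noteq> 0" "q \<noteq> 0" "e2 \<noteq> 0"
    and "c1 * (b - q) = (a - q) * c2" "e1 * (b - q) = (a - b * q) * e2"
  shows "c2 * (a - b) * q ^ 2 / (b * (a - q ^ 2))
     + - (q / (b * (q - 1))) * ((q - 1) * (c1 - c1 * (b - q) / (a - q)))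
     - - (c2 * (a - b) * q ^ 2 / (b * (a - q ^ 2)) / (q * e2)) * e1 = 0"
proof -
  \<comment> \<open>The common factors \<open>t\<close> and \<open>u\<close> solve the recursions
    without division, leaving polynomial multiples of \<open>t\<close> and \<open>u\<close>.\<close>
  define t where "t = c2 / (b - q)"
  define u where "u = e2 / (b - q)"
  have e: "c2 = (b - q) * t" "c1 = (a - q) * t" "e2 = (b - q) * u" "e1 = (a - b * q) * u"
    using assms by (simp_all add: t_def u_def field_simps)
  have "u \<noteq> 0" using assms by (simp add: u_def)
  then show ?thesis
    unfolding e using assms(1-6) by (simp add: divide_simps) algebra
qed

lemma disjointness_kernel_eigenvalue_0:
  fixes a b q :: real
  assumes "a - q \<noteq> 0" "b \<noteq> 0" "q - 1 \<noteq> 0" "b - q \<noteq> 0" "a - q ^ 2 \<noteq> 0" "q \<noteq> 0" "e2 \<noteq> 0" "b - 1 \<noteq> 0"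
    and "c1 * (b - q) = (a - q) * c2" "e1 * (b - q) = (a - b * q) * e2"
    and "c0 * (b - 1) = (a - 1) * c1" "e0 * (b - 1) = (a - b) * e1"
  shows "c2 * (a - b) * q ^ 2 / (b * (a - q ^ 2))
     + (q / (b * (q - 1)) * b - q * (b - q) * (a - b) / (b * (q - 1) * (a - q ^ 2))) * c0
     + - (q / (b * (q - 1))) * (c0 + (b - 1) * c1)
     + - (c2 * (a - b) * q ^ 2 / (b * (a - q ^ 2)) / (q * e2)) * e0 = 0"
proof -
  define t where "t = c2 / ((b - q) * (b - 1))"
  define u where "u = e2 / ((b - q) * (b - 1))"
  have e: "c2 = (b - q) * (b - 1) * t" "e2 = (b - q) * (b - 1) * u"
    using assms by (simp_all add: t_def u_def)
  have "c1 * (b - q) = (a - q) * (b - 1) * t * (b - q)" "e1 * (b - q) = (a - b * q) * (b - 1) * u * (b - q)"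
    using assms(9,10) unfolding e by (simp_all add: algebra_simps)
  then have e1: "c1 = (a - q) * (b - 1) * t" "e1 = (a - b * q) * (b - 1) * u"
    using assms(4) by simp_all
  have "c0 * (b - 1) = (a - 1) * (a - q) * t * (b - 1)" "e0 * (b - 1) = (a - b) * (a - b * q) * u * (b - 1)"
    using assms(11,12) unfolding e1 by (simp_all add: algebra_simps)
  then have e0: "c0 = (a - 1) * (a - q) * t" "e0 = (a - b) * (a - b * q) * u"
    using assms(8) by simp_all
  have "u \<noteq> 0" using assms by (simp add: u_def)
  then show ?thesis
    unfolding e e1 e0 using assms(1-6,8) by (simp add: divide_simps) algebra
qed

text \<open>Brings \<alpha> \<open>M\<close> - \<phi> \<open>M ^ 2\<close> into the closed form of
  the first bound; \<open>a / b\<close> plays the part of \<open>q ^ (n - k)\<close>, and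
  \<open>N\<close> that of the number of \<open>k\<close>-spaces.\<close>

lemma general_bound_eq:
  fixes a b q M N :: real
  assumes "a - 1 \<noteq> 0" "a - q \<noteq> 0" "b \<noteq> 0" "q - 1 \<noteq> 0" "M \<noteq> 0"
  shows "q * N * (b - 1) * (a - b) / (b * (a - 1) * (a - q)) * M - q * (b - 1) * (a - b) / (b * (q - 1) * (a - q)) * M ^ 2
   = (N / M - (a - 1) / (q - 1)) * (q * M ^ 2 * ((b - 1) / (q - 1)) * ((a / b - 1) / (q - 1))
              / ((a - 1) / (q - 1) * ((a - 1) / (q - 1) - 1)))"
proof -
  have "(a - 1) / (q - 1) - 1 = (a - q) / (q - 1)" using assms by (simp add: field_simps)
  moreover have "a / b - 1 = (a - b) / b" using assms by (simp add: field_simps)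
  ultimately show ?thesis using assms by (simp add: divide_simps) algebra
qed

text \<open>The same conversion for the second bound, where \<open>a / q\<close>,
  \<open>a / q ^ 2\<close> and \<open>b / q\<close> are the shifted powers.\<close>

lemma disjointness_bound_eq:
  fixes a b q M N :: real
  assumes "a - 1 \<noteq> 0" "a - q \<noteq> 0" "a - q ^ 2 \<noteq> 0" "b \<noteq> 0" "b - 1 \<noteq> 0" "b - q \<noteq> 0" "q - 1 \<noteq> 0" "q \<noteq> 0" "M \<noteq> 0"
    and "c1 * (b - q) = (a - q) * c2" "N * (b - 1) = (a - 1) * c1"
  shows "c2 * (a - b) * q ^ 2 / (b * (a - q ^ 2)) * M - q * (b - q) * (a - b) / (b * (q - 1) * (a - q ^ 2)) * M ^ 2
   = (N / M - ((a - 1) * (a / q - 1)) / ((q - 1) * (b - 1)))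
          * (M ^ 2 * (b - 1) * (b / q - 1) * (a / b - 1)
              / ((a - 1) * (a / q - 1) * (a / q ^ 2 - 1)))"
proof -
  have "a / q - 1 = (a - q) / q" "b / q - 1 = (b - q) / q" "a / b - 1 = (a - b) / b" "a / q ^ 2 - 1 = (a - q ^ 2) / q ^ 2"
    using assms by (simp_all add: field_simps)
  moreover have "c1 = (a - q) * c2 / (b - q)" "N = (a - 1) * c1 / (b - 1)"
    using assms by (simp_all add: field_simps)
  ultimately show ?thesis using assms by (simp add: divide_simps) algebra
qed

section \<open>Bounds on the total intersection of one family\<close>

context finite_field_vector_space
begin

lemma gauss_binomial_eq_num_ext:
  assumes "k \<le> n"
  shows "gauss_binomial q n k = num_ext k 0 0"
proof -
  have "(real q ^ (n - i) - 1) / (real q ^ (k - i) - 1) = (real q ^ n - real q ^ i) / (real q ^ k - real q ^ i)"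
    if "i < k" for i
  proof -
    have "real q ^ n = real q ^ i * real q ^ (n - i)" "real q ^ k = real q ^ i * real q ^ (k - i)"
      using that assms by (simp_all add: power_add[symmetric])
    then have "(real q ^ n - real q ^ i) / (real q ^ k - real q ^ i)
        = (real q ^ i * (real q ^ (n - i) - 1)) / (real q ^ i * (real q ^ (k - i) - 1))"
      by (simp add: algebra_simps)
    also have "\<dots> = (real q ^ (n - i) - 1) / (real q ^ (k - i) - 1)"
      using q_ge_2 by simp
    finally show ?thesis by simp
  qed
  then show ?thesis
    unfolding gauss_binomial_def num_ext_def by (intro prod.cong) auto
qed

lemma gauss_binomial_one: "gauss_binomial q m 1 = (real q ^ m - 1) / (real q - 1)"
  by (simp add: gauss_binomial_def)

lemma dim_le_power_diff:
  assumes "A \<in> Gr k" "B \<in> Gr k"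
  shows "real (dim (A \<inter> B)) \<le> real k - real q / (real q ^ k * (real q - 1)) * (real q ^ k - real q ^ dim (A \<inter> B))"
proof -
  have "dim (A \<inter> B) \<le> k"
    using assms dim_subset[of "A \<inter> B" A] by (simp add: Gr_iff)
  moreover have "1 < real q" using q_ge_2 by simp
  ultimately show ?thesis
    using diff_ge_power_diff[of "real q" "dim (A \<inter> B)" k] by linarith
qed

text \<open>Serves the second bound for \<open>k = 1\<close>, where there is no eigenvalue for
  \<open>j = 2\<close> to adjust.\<close>

lemma total_intersection_le_trivial:
  assumes G: "\<G> \<subseteq> Gr k"
  shows "real (total_intersection scale \<G>) \<le> real k * real (card \<G>) ^ 2"
proof -
  have "dim (A \<inter> B) \<le> k" if "A \<in> \<G>" for A B
    using that G dim_subset[of "A \<inter> B" A] by (auto simp: Gr_iff)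
  then have "total_intersection scale \<G> \<le> (\<Sum>A\<in>\<G>. \<Sum>B\<in>\<G>. k)"
    unfolding total_intersection_def by (intro sum_mono)
  also have "\<dots> = k * card \<G> ^ 2" by (simp add: power2_eq_square)
  finally have "real (total_intersection scale \<G>) \<le> real (k * card \<G> ^ 2)"
    by (simp only: of_nat_le_iff)
  then show ?thesis by simp
qed

lemma total_intersection_le_linear_programming:
  fixes \<alpha> \<phi> \<psi> :: real and k :: nat
  defines "\<kappa> \<equiv> real q / (real q ^ k * (real q - 1))"
  assumes k: "1 \<le> k" "k \<le> n" and n: "2 \<le> n" and psi: "\<psi> \<le> 0"
    and h0: "\<alpha> + (\<kappa> * real q ^ k - \<phi>) * num_ext k 0 0 + - \<kappa> * (num_ext k 0 0 + (real q ^ k - 1) * num_ext k 0 1)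
      + \<psi> * num_ext k k 0 = 0"
    and h1: "\<alpha> + - \<kappa> * ((real q - 1) * (num_ext k 0 1 - num_ext k 0 1 * (real q ^ k - real q) / (real q ^ n - real q)))
      - \<psi> * num_ext k k 1 = 0"
    and hj: "\<And>j. 2 \<le> j \<Longrightarrow> j \<le> k \<Longrightarrow> 0 \<le> \<alpha> + \<psi> * ((- 1) ^ j * real q ^ (j choose 2) * num_ext k k j)"
    and G: "\<G> \<subseteq> Gr k"
  shows "real (total_intersection scale \<G>) \<le> \<alpha> * real (card \<G>) - \<phi> * real (card \<G>) ^ 2 + real k * real (card \<G>) ^ 2"
proof -
  define M where "M = real (card \<G>)"
  have fin: "finite \<G>" using G by (rule finite_subset) simp
  define H where "H A B = \<alpha> * of_bool (A = B) + (\<kappa> * real q ^ k - \<phi>) + - \<kappa> * real q ^ dim (A \<inter> B)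
      + \<psi> * of_bool (A \<inter> B = {0})" for A B
  have restrict: "(\<Sum>A\<in>Gr k. f A * of_bool (A \<in> \<G>)) = (\<Sum>A\<in>\<G>. f A)" for f :: "'v set \<Rightarrow> real"
  proof -
    have "Gr k \<inter> {A. A \<in> \<G>} = \<G>" using G by blast
    then show ?thesis by simp
  qed
  have "0 \<le> (\<Sum>A\<in>Gr k. \<Sum>B\<in>Gr k. H A B * of_bool (A \<in> \<G>) * of_bool (B \<in> \<G>))"
    unfolding H_def using k n hj by (intro intersection_form_nonneg) (simp_all only: h0 h1 order_refl)
  also have "\<dots> = (\<Sum>A\<in>Gr k. (\<Sum>B\<in>\<G>. H A B) * of_bool (A \<in> \<G>))"
    unfolding restrict sum_distrib_right ..
  also have "\<dots> = (\<Sum>A\<in>\<G>. \<Sum>B\<in>\<G>. H A B)"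
    by (rule restrict)
  also have "\<dots> \<le> (\<Sum>A\<in>\<G>. \<Sum>B\<in>\<G>. \<alpha> * of_bool (A = B) + (real k - \<phi>) - real (dim (A \<inter> B)))"
  proof (intro sum_mono)
    fix A B assume "A \<in> \<G>" "B \<in> \<G>"
    then have "real (dim (A \<inter> B)) \<le> real k - \<kappa> * (real q ^ k - real q ^ dim (A \<inter> B))"
      unfolding \<kappa>_def using G by (intro dim_le_power_diff) auto
    moreover have "\<psi> * of_bool (A \<inter> B = {0}) \<le> 0"
      using psi by (simp add: mult_nonpos_nonneg)
    ultimately show "H A B \<le> \<alpha> * of_bool (A = B) + (real k - \<phi>) - real (dim (A \<inter> B))"
      by (simp add: H_def algebra_simps)
  qed
  also have "\<dots> = (\<Sum>A\<in>\<G>. \<Sum>B\<in>\<G>. \<alpha> * of_bool (A = B)) + (real k - \<phi>) * M ^ 2 - real (total_intersection scale \<G>)"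
    by (simp only: sum.distrib sum_subtractf sum_constant total_intersection_def of_nat_sum M_def
        power2_eq_square algebra_simps)
  also have "(\<Sum>A\<in>\<G>. \<Sum>B\<in>\<G>. \<alpha> * of_bool (A = B)) = \<alpha> * M"
  proof -
    have "(\<Sum>B\<in>\<G>. \<alpha> * of_bool (A = B)) = \<alpha>" if "A \<in> \<G>" for A
    proof -
      have "\<G> \<inter> {B. A = B} = {A}" using that by blast
      then show ?thesis using fin by simp
    qed
    then show ?thesis by (simp add: M_def)
  qed
  finally show ?thesis by (simp add: M_def algebra_simps)
qed

lemma num_ext_zero_rec: "1 \<le> k \<Longrightarrow> num_ext k a 0 * (real q ^ k - 1) = (real q ^ n - real q ^ a) * num_ext k a 1"
  using num_ext_rec[of 0 k a] by simp

lemma num_ext_one_rec: "2 \<le> k \<Longrightarrow> num_ext k a 1 * (real q ^ k - real q) = (real q ^ n - real q ^ a * real q) * num_ext k a 2"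
  using num_ext_rec[of 1 k a] by (simp add: numeral_2_eq_2 mult.commute)

lemma power_q_less: "i < j \<Longrightarrow> real q ^ i < real q ^ j"
  using q_ge_2 by (intro power_strict_increasing) auto

lemma total_intersection_le_general:
  assumes k: "1 \<le> k" "k \<le> n" and n: "2 \<le> n" and G: "\<G> \<subseteq> Gr k" and M: "M = card \<G>" "M \<ge> 1"
  shows "real (total_intersection scale \<G>) \<le>
     (gauss_binomial q n k / real M - gauss_binomial q n 1)
          * (real q * real M ^ 2 * gauss_binomial q k 1 * gauss_binomial q (n - k) 1
              / (gauss_binomial q n 1 * (gauss_binomial q n 1 - 1)))
        + real k * real M ^ 2"
proof -
  define a where "a = real q ^ n"
  define b where "b = real q ^ k"
  define N where "N = num_ext k 0 0"
  have q: "1 < real q" using q_ge_2 by simp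
  have ab: "b \<le> a" "real q < a" "1 < b" "1 < a"
    using power_q_less[of 1 n] power_q_less[of 0 k] power_q_less[of 0 n] k n q
    by (auto simp: a_def b_def intro!: power_increasing)
  have N_pos: "N \<ge> 0"
    unfolding N_def using card_Gr by (metis of_nat_0_le_iff)
  have "real (total_intersection scale \<G>) \<le>
     real q * N * (b - 1) * (a - b) / (b * (a - 1) * (a - real q)) * real (card \<G>)
      - real q * (b - 1) * (a - b) / (b * (real q - 1) * (a - real q)) * real (card \<G>) ^ 2
      + real k * real (card \<G>) ^ 2"
  proof (rule total_intersection_le_linear_programming[where \<psi> = 0])
    \<comment> \<open>Without a disjointness term every eigenvalue for \<open>j >= 2\<close> equals
      \<alpha>.\<close>
    show "0 \<le> real q * N * (b - 1) * (a - b) / (b * (a - 1) * (a - real q))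
        + 0 * ((- 1) ^ j * real q ^ (j choose 2) * num_ext k k j)" for j
      using ab N_pos q by (auto intro!: divide_nonneg_nonneg mult_nonneg_nonneg)
  qed (use k n G ab q num_ext_zero_rec[of k 0] in
      \<open>simp_all only: mult_zero_left add_0_right diff_0_right order_refl a_def[symmetric] b_def[symmetric] N_def[symmetric]
        general_kernel_eigenvalue_0 general_kernel_eigenvalue_1 power_0\<close>)
  also have "\<dots> = (N / real M - (a - 1) / (real q - 1))
      * (real q * real M ^ 2 * ((b - 1) / (real q - 1)) * ((a / b - 1) / (real q - 1))
        / ((a - 1) / (real q - 1) * ((a - 1) / (real q - 1) - 1))) + real k * real M ^ 2"
    unfolding M(1)[symmetric] using ab q M(2) by (subst general_bound_eq) auto
  also have "a / b = real q ^ (n - k)"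
    using k q by (simp add: a_def b_def power_diff)
  finally show ?thesis
    by (simp only: gauss_binomial_eq_num_ext[OF k(2)] gauss_binomial_one N_def a_def b_def)
qed

section \<open>The kernel with a disjointness term, for \<open>2 * k <= n\<close>\<close>

lemma num_ext_disjoint_pos: "2 * k \<le> n \<Longrightarrow> 0 < num_ext k k j"
  unfolding num_ext_def by (intro prod_pos) (auto intro!: divide_pos_pos power_q_less)

text \<open>Up to sign, the left-hand side is the eigenvalue of the disjointness relation for \<open>j\<close>; the right-hand
  side is that for \<open>j = 2\<close>.\<close>
lemma disjointness_eigenvalue_le:
  assumes "2 * k \<le> n" "2 \<le> j" "j \<le> k"
  shows "real q ^ (j choose 2) * num_ext k k j \<le> real q * num_ext k k 2"
  using assms(2,3)
proof (induction j rule: dec_induct)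
  case base
  then show ?case by simp
next
  case (step j)
  have pos: "real q ^ k - real q ^ j > 0" using power_q_less[of j k] step by simp
  \<comment> \<open>Here \<open>j < k\<close>, so \<open>k + j + 1 <= n\<close>, and one factor
    \<open>q\<close> absorbs the 2. The consequence \<open>le\<close> says that passing from
    \<open>j\<close> to \<open>j + 1\<close> does not increase the quantity.\<close>
  have "2 * real q ^ (k + j) \<le> real q ^ n"
  proof -
    have "2 * real q ^ (k + j) \<le> real q ^ Suc (k + j)" using q_ge_2 by simp
    also have "\<dots> \<le> real q ^ n" using q_ge_2 step assms by (intro power_increasing) auto
    finally show ?thesis .
  qed
  then have le: "real q ^ j * (real q ^ k - real q ^ j) \<le> real q ^ n - real q ^ (k + j)"
    by (simp add: algebra_simps power_add)
      (smt (verit) zero_le_power mult_nonneg_nonneg of_nat_0_le_iff)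
  have choose: "Suc j choose 2 = j + (j choose 2)" by (simp add: numeral_2_eq_2)
  have "real q ^ (Suc j choose 2) * num_ext k k (Suc j) * (real q ^ k - real q ^ j)
      = real q ^ (j choose 2) * (real q ^ j * (real q ^ k - real q ^ j) * num_ext k k (Suc j))"
    by (simp add: choose power_add mult_ac)
  also have "\<dots> \<le> real q ^ (j choose 2) * ((real q ^ n - real q ^ (k + j)) * num_ext k k (Suc j))"
    using le num_ext_disjoint_pos[OF assms(1), of "Suc j"] by (intro mult_left_mono mult_right_mono) auto
  also have "\<dots> = real q ^ (j choose 2) * num_ext k k j * (real q ^ k - real q ^ j)"
    using num_ext_rec[of j k k] step by simp
  finally have "real q ^ (Suc j choose 2) * num_ext k k (Suc j) \<le> real q ^ (j choose 2) * num_ext k k j"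
    using pos by (simp only: mult_le_cancel_right_pos)
  then show ?case using step by simp
qed

text \<open>With \<open>k >= 2\<close> the eigenvalue for \<open>j = 2\<close> is present and
  \<open>b - q\<close> is nonzero, so \<alpha> = \<open>F\<close> and \<psi> can be solved from the
  equations for \<open>j = 1\<close> and \<open>j = 2\<close>.\<close>

lemma total_intersection_le_if_2k_le_n:
  assumes k: "2 \<le> k" and n: "2 * k \<le> n" and G: "\<G> \<subseteq> Gr k" and M: "M = card \<G>" "M \<ge> 1"
  shows "real (total_intersection scale \<G>) \<le>
     (gauss_binomial q n k / real M
            - ((real q ^ n - 1) * (real q ^ (n - 1) - 1)) / ((real q - 1) * (real q ^ k - 1)))
          * (real M ^ 2 * (real q ^ k - 1) * (real q ^ (k - 1) - 1) * (real q ^ (n - k) - 1)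
              / ((real q ^ n - 1) * (real q ^ (n - 1) - 1) * (real q ^ (n - 2) - 1)))
        + real k * real M ^ 2"
proof -
  define a where "a = real q ^ n"
  define b where "b = real q ^ k"
  define c2 where "c2 = num_ext k 0 2"
  define e2 where "e2 = num_ext k k 2"
  define F where "F = c2 * (a - b) * real q ^ 2 / (b * (a - real q ^ 2))"
  have kn: "k \<le> n" "1 \<le> k" "2 \<le> n" using k n by auto
  have q: "1 < real q" using q_ge_2 by simp
  have ab: "b < a" "real q < a" "1 < b" "1 < a" "real q < b" "real q ^ 2 < a"
    using power_q_less[of 1 n] power_q_less[of 0 k] power_q_less[of 0 n] power_q_less[of 1 k]
      power_q_less[of 2 n] power_q_less[of k n] k n
    by (simp_all add: a_def b_def)
  have c2_pos: "c2 \<ge> 0"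
    unfolding c2_def num_ext_def using kn q
    by (intro prod_nonneg) (auto intro!: divide_nonneg_nonneg power_increasing)
  have e2_pos: "e2 > 0"
    unfolding e2_def by (rule num_ext_disjoint_pos[OF n])
  have F_pos: "F \<ge> 0"
    unfolding F_def using c2_pos ab q by (auto intro!: divide_nonneg_nonneg mult_nonneg_nonneg)
  have r: "num_ext k 0 0 * (b - 1) = (a - 1) * num_ext k 0 1" "num_ext k k 0 * (b - 1) = (a - b) * num_ext k k 1"
      "num_ext k 0 1 * (b - real q) = (a - real q) * c2" "num_ext k k 1 * (b - real q) = (a - b * real q) * e2"
    using num_ext_zero_rec[of k 0] num_ext_zero_rec[of k k] num_ext_one_rec[of k 0] num_ext_one_rec[of k k] k kn
    by (simp_all add: a_def b_def c2_def e2_def)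
  have "real (total_intersection scale \<G>) \<le> F * real (card \<G>)
      - real q * (b - real q) * (a - b) / (b * (real q - 1) * (a - real q ^ 2)) * real (card \<G>) ^ 2
      + real k * real (card \<G>) ^ 2"
  proof (rule total_intersection_le_linear_programming[where \<psi> = "- (F / (real q * e2))"])
    show "- (F / (real q * e2)) \<le> 0" using F_pos e2_pos q by simp
    show "F + (real q / (real q ^ k * (real q - 1)) * real q ^ k
        - real q * (b - real q) * (a - b) / (b * (real q - 1) * (a - real q ^ 2))) * num_ext k 0 0
      + - (real q / (real q ^ k * (real q - 1))) * (num_ext k 0 0 + (real q ^ k - 1) * num_ext k 0 1)
      + - (F / (real q * e2)) * num_ext k k 0 = 0"
      unfolding F_def b_def[symmetric] by (rule disjointness_kernel_eigenvalue_0) (use ab q e2_pos r in auto)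
    show "F + - (real q / (real q ^ k * (real q - 1))) * ((real q - 1) *
        (num_ext k 0 1 - num_ext k 0 1 * (real q ^ k - real q) / (real q ^ n - real q)))
      - - (F / (real q * e2)) * num_ext k k 1 = 0"
      unfolding F_def b_def[symmetric] a_def[symmetric] by (rule disjointness_kernel_eigenvalue_1) (use ab q e2_pos r in auto)
    show "0 \<le> F + - (F / (real q * e2)) * ((- 1) ^ j * real q ^ (j choose 2) * num_ext k k j)"
      if j: "2 \<le> j" "j \<le> k" for j
    proof -
      define t where "t = real q ^ (j choose 2) * num_ext k k j"
      have t: "0 \<le> t" "t \<le> real q * e2"
        using disjointness_eigenvalue_le[OF n j] num_ext_disjoint_pos[OF n, of j] by (simp_all add: t_def e2_def)
      \<comment> \<open>For odd \<open>j\<close> the sign already helps; for even \<open>j\<close>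
        the disjointness eigenvalue is largest at \<open>j = 2\<close>, where \<alpha> is cancelled
        exactly.\<close>
      have "(- 1) ^ j * t \<le> real q * e2"
        using t by (cases "even j") auto
      then have "F / (real q * e2) * ((- 1) ^ j * t) \<le> F / (real q * e2) * (real q * e2)"
        using F_pos e2_pos q by (intro mult_left_mono) auto
      also have "\<dots> = F" using e2_pos q by simp
      finally show ?thesis by (simp add: t_def mult_ac)
    qed
  qed (use kn G in auto)
  also have "\<dots> = (num_ext k 0 0 / real M - ((a - 1) * (a / real q - 1)) / ((real q - 1) * (b - 1)))
          * (real M ^ 2 * (b - 1) * (b / real q - 1) * (a / b - 1)
              / ((a - 1) * (a / real q - 1) * (a / real q ^ 2 - 1))) + real k * real M ^ 2"
    unfolding M(1)[symmetric] F_def using ab q M(2) r by (subst disjointness_bound_eq) auto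
  finally have "real (total_intersection scale \<G>) \<le> (num_ext k 0 0 / real M - ((a - 1) * (a / real q - 1)) / ((real q - 1) * (b - 1)))
          * (real M ^ 2 * (b - 1) * (b / real q - 1) * (a / b - 1)
              / ((a - 1) * (a / real q - 1) * (a / real q ^ 2 - 1))) + real k * real M ^ 2" .
  moreover have "a / b = real q ^ (n - k)" "a / real q = real q ^ (n - 1)" "a / real q ^ 2 = real q ^ (n - 2)"
      "b / real q = real q ^ (k - 1)"
    using kn q by (simp_all add: a_def b_def power_diff)
  ultimately show ?thesis
    by (simp only: gauss_binomial_eq_num_ext[OF kn(1)] a_def b_def)
qed

end

section \<open>From single families to the maximum\<close>

theorem theorem1p7:
  fixes smul :: "'f::{field,finite} \<Rightarrow> 'v::ab_group_add \<Rightarrow> 'v"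
    and q n k M :: nat
    and \<F> :: "'v set set"
  assumes "primepow q" and "CARD('f) = q"
    and "n \<ge> 2" and "k \<ge> 1" and "M \<ge> 1"
    and "k \<le> n" and "real M \<le> gauss_binomial q n k"
    and "vector_space smul" and "vector_space.dim smul (UNIV :: 'v set) = n"
    and "\<F> \<subseteq> subspaces_of_dim smul k" and "card \<F> = M"
  shows "real (max_total_intersection smul k \<F>)
      \<le> (gauss_binomial q n k / real M - gauss_binomial q n 1)
          * (real q * real M ^ 2 * gauss_binomial q k 1 * gauss_binomial q (n - k) 1
              / (gauss_binomial q n 1 * (gauss_binomial q n 1 - 1)))
        + real k * real M ^ 2
    \<and> (n \<ge> 2 * k \<and> n \<ge> 3 \<and> real M \<le> gauss_binomial q (n - 1) (k - 1) \<longrightarrow>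
      real (max_total_intersection smul k \<F>)
      \<le> (gauss_binomial q n k / real M
            - ((real q ^ n - 1) * (real q ^ (n - 1) - 1)) / ((real q - 1) * (real q ^ k - 1)))
          * (real M ^ 2 * (real q ^ k - 1) * (real q ^ (k - 1) - 1) * (real q ^ (n - k) - 1)
              / ((real q ^ n - 1) * (real q ^ (n - 1) - 1) * (real q ^ (n - 2) - 1)))
        + real k * real M ^ 2)"
proof -
  interpret vs: vector_space smul by fact
  obtain Basis :: "'v set" where B: "vs.independent Basis" "UNIV \<subseteq> vs.span Basis" "card Basis = n"
    using vs.basis_exists[of UNIV] assms(9) by metis
  \<comment> \<open>An infinite set has cardinality 0 by default, so the positive value
    \<open>n\<close> forces finiteness.\<close>
  have "finite Basis" using B(3) assms(3) by (intro card_ge_0_finite) simp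
  with B interpret finite_field_vector_space smul Basis q n
    using assms(2,9) by unfold_locales auto
  \<comment> \<open>The set of values is finite and nonempty, so its maximum is attained by some
    family of the same size, to which the bounds for single families apply.\<close>
  define T where "T = {total_intersection smul \<G> | \<G>. \<G> \<subseteq> subspaces_of_dim smul k \<and> card \<G> = card \<F>}"
  have "T \<subseteq> total_intersection smul ` Pow (Gr k)" by (auto simp: T_def)
  then have "finite T" by (rule finite_subset) simp
  moreover have "T \<noteq> {}" using assms(10) by (auto simp: T_def)
  ultimately have "Max T \<in> T" by (rule Max_in)
  then obtain \<G> where G: "\<G> \<subseteq> Gr k" "M = card \<G>" and max: "max_total_intersection smul k \<F> = total_intersection smul \<G>"
    using assms(11) by (auto simp: T_def max_total_intersection_def)
  have "real (total_intersection smul \<G>)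
      \<le> (gauss_binomial q n k / real M
            - ((real q ^ n - 1) * (real q ^ (n - 1) - 1)) / ((real q - 1) * (real q ^ k - 1)))
          * (real M ^ 2 * (real q ^ k - 1) * (real q ^ (k - 1) - 1) * (real q ^ (n - k) - 1)
              / ((real q ^ n - 1) * (real q ^ (n - 1) - 1) * (real q ^ (n - 2) - 1)))
        + real k * real M ^ 2" if "n \<ge> 2 * k"
  proof (cases "k = 1")
    \<comment> \<open>For \<open>k = 1\<close> the factor \<open>q ^ (k - 1) - 1\<close> is zero,
      and the bound reduces to \<open>k * M ^ 2\<close>.\<close>
    case True
    then show ?thesis
      using total_intersection_le_trivial[OF G(1)] G(2) by simp
  next
    case False
    then show ?thesis
      using assms(4,5) that G by (intro total_intersection_le_if_2k_le_n) auto
  qed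
  then show ?thesis
    unfolding max using total_intersection_le_general[OF assms(4,6,3) G assms(5)] by blast
qed

end
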